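(* Let $\mathbf{C}$ be a category. Giving a 2-cell structure over $\mathbf{C}$ is to give, for every pair $(A,B)$ of objects in $\mathbf{C}$, a set $H(A,B)$, together with maps $$\mathrm{dom},\mathrm{cod}\colon H(A,B)\to\hom(A,B),\qquad 0\colon \hom(A,B)\to H(A,B),\ f\mapsto 0_f,$$ $$+\colon H(A,B)\times_{\hom(A,B)}H(A,B)\to H(A,B),\ (x,x')\mapsto x+x',$$ and actions (for all objects $A,B,C$) $$H(B,C)\times\hom(A,B)\to H(A,C),\ (x,f)\mapsto xf,\qquad \hom(B,C)\times H(A,B)\to H(A,C),\ (g,y)\mapsto gy,$$ satisfying the following conditions (for all morphisms $f,f',g,g'$ and all elements $x,x',x'',y,y'$ of the sets $H(-,-)$ for which the expressions make sense): (1) $\mathrm{dom}(gy)=g\,\mathrm{dom}(y)$, $\mathrm{dom}(xf)=\mathrm{dom}(x)f$, $\mathrm{cod}(gy)=g\,\mathrm{cod}(y)$, $\mathrm{cod}(xf)=\mathrm{cod}(x)f$, $g0_f=0_{gf}=0_gf$, $(x+x')f=xf+x'f$, $g(y+y')=gy+gy'$; (2) $g'(gy)=(g'g)y$, $(xf)f'=x(ff')$, $g'(xf)=(g'x)f$, $1_Cx=x=x1_B$ (where $x\in H(B,C)$); (3) $\mathrm{dom}(0_f)=f=\mathrm{cod}(0_f)$, $\mathrm{dom}(x+x')=\mathrm{dom}(x')$, $\mathrm{cod}(x+x')=\mathrm{cod}(x)$, $0_{\mathrm{cod}(x)}+x=x=x+0_{\mathrm{dom}(x)}$, $x+(x'+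x'')=(x+x')+x''$.
   Context: A 2-cell structure on (or over) a category $\mathbf{C}$ is a system $\mathbf{H}=(H,\mathrm{dom},\mathrm{cod},0,+)$ where $H\colon\mathbf{C}^{op}\times\mathbf{C}\to\mathsf{Set}$ is a functor and $\mathrm{dom},\mathrm{cod}\colon H\to\hom$, $0\colon\hom\to H$, $+\colon H\times_{\hom}H\to H$ are natural transformations such that $(\hom,H,\mathrm{dom},\mathrm{cod},0,+)$ is an internal category in the functor category $\mathsf{Set}^{\mathbf{C}^{op}\times\mathbf{C}}$, with object of objects $\hom$, object of morphisms $H$, domain $\mathrm{dom}$, codomain $\mathrm{cod}$, identities $0$ and composition $+$. Here $\hom$ denotes the hom functor $\hom_{\mathbf{C}}\colon\mathbf{C}^{op}\times\mathbf{C}\to\mathsf{Set}$ of $\mathbf{C}$ (so $\mathbf{C}$ is locally small), and $H\times_{\hom}H$ is the pullback consisting of the pairs $(x,x')$ with $\mathrm{dom}(x)=\mathrm{cod}(x')$, so that $x+x'$ is the composite "first $x'$, then $x$"; $H(A,B)\times_{\hom(A,B)}H(A,B)$ is likewise the set of pairs $(x,x')$ of elements of $H(A,B)$ with $\mathrm{dom}(x)=\mathrm{cod}(x')$. *)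

theory Defs
  imports Main "HOL-Library.FuncSet"
begin

section \<open>Categories, functors, natural transformations\<close>

record ('o, 'm) cat =
  Ob :: "'o set"
  Ar :: "'m set"
  src :: "'m \<Rightarrow> 'o"
  tgt :: "'m \<Rightarrow> 'o"
  idt :: "'o \<Rightarrow> 'm" ("\<one>\<index>")
  cmp :: "'m \<Rightarrow> 'm \<Rightarrow> 'm" (infixl "\<cdot>\<index>" 70)

definition hom :: "('o, 'm) cat \<Rightarrow> 'o \<Rightarrow> 'o \<Rightarrow> 'm set" where
  "hom \<C> A B = {f \<in> Ar \<C>. src \<C> f = A \<and> tgt \<C> f = B}"

locale category =
  fixes \<C> :: "('o, 'm) cat" (structure)
  assumes src_Ob: "f \<in> Ar \<C> \<Longrightarrow> src \<C> f \<in> Ob \<C>"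
    and tgt_Ob: "f \<in> Ar \<C> \<Longrightarrow> tgt \<C> f \<in> Ob \<C>"
    and idt_hom: "A \<in> Ob \<C> \<Longrightarrow> \<one> A \<in> hom \<C> A A"
    and cmp_hom: "\<lbrakk>f \<in> hom \<C> A B; g \<in> hom \<C> B C\<rbrakk> \<Longrightarrow> g \<cdot> f \<in> hom \<C> A C"
    and cmp_idt_right: "f \<in> hom \<C> A B \<Longrightarrow> f \<cdot> \<one> A = f"
    and cmp_idt_left: "f \<in> hom \<C> A B \<Longrightarrow> \<one> B \<cdot> f = f"
    and cmp_assoc: "\<lbrakk>f \<in> hom \<C> A B; g \<in> hom \<C> B C; h \<in> hom \<C> C D\<rbrakk>
      \<Longrightarrow> h \<cdot> (g \<cdot> f) = (h \<cdot> g) \<cdot> f"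

definition op_cat :: "('o, 'm) cat \<Rightarrow> ('o, 'm) cat" where
  "op_cat \<C> = \<lparr>Ob = Ob \<C>, Ar = Ar \<C>, src = tgt \<C>, tgt = src \<C>, idt = idt \<C>,
     cmp = (\<lambda>g f. cmp \<C> f g)\<rparr>"

definition prod_cat ::
    "('o1, 'm1) cat \<Rightarrow> ('o2, 'm2) cat \<Rightarrow> ('o1 \<times> 'o2, 'm1 \<times> 'm2) cat" where
  "prod_cat \<C> \<D> = \<lparr>Ob = Ob \<C> \<times> Ob \<D>, Ar = Ar \<C> \<times> Ar \<D>,
     src = (\<lambda>(f, g). (src \<C> f, src \<D> g)), tgt = (\<lambda>(f, g). (tgt \<C> f, tgt \<D> g)),
     idt = (\<lambda>(A, B). (idt \<C> A, idt \<D> B)),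
     cmp = (\<lambda>(f', g') (f, g). (cmp \<C> f' f, cmp \<D> g' g))\<rparr>"

record ('o1, 'm1, 'o2, 'm2) fctr =
  fob :: "'o1 \<Rightarrow> 'o2"
  far :: "'m1 \<Rightarrow> 'm2"

text \<open>
  Functors and natural transformations are required to be \<open>undefined\<close> outside the objects and
  arrows of their source category, so that equality in HOL is equality of functors and of
  natural transformations.
\<close>

definition is_functor ::
    "('o1, 'm1) cat \<Rightarrow> ('o2, 'm2) cat \<Rightarrow> ('o1, 'm1, 'o2, 'm2) fctr \<Rightarrow> bool" where
  "is_functor \<J> \<E> F \<longleftrightarrow>
     fob F \<in> Ob \<J> \<rightarrow>\<^sub>E Ob \<E> \<and>
     far F \<in> extensional (Ar \<J>) \<and>
     (\<forall>u \<in> Ar \<J>. far F u \<in> hom \<E> (fob F (src \<J> u)) (fob F (tgt \<J> u))) \<and>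
     (\<forall>j \<in> Ob \<J>. far F (idt \<J> j) = idt \<E> (fob F j)) \<and>
     (\<forall>u \<in> Ar \<J>. \<forall>v \<in> Ar \<J>. tgt \<J> u = src \<J> v \<longrightarrow>
        far F (cmp \<J> v u) = cmp \<E> (far F v) (far F u))"

record ('o1, 'm1, 'o2, 'm2) ntrans =
  nsrc :: "('o1, 'm1, 'o2, 'm2) fctr"
  ntgt :: "('o1, 'm1, 'o2, 'm2) fctr"
  at :: "'o1 \<Rightarrow> 'm2"

definition is_ntrans ::
    "('o1, 'm1) cat \<Rightarrow> ('o2, 'm2) cat \<Rightarrow> ('o1, 'm1, 'o2, 'm2) ntrans \<Rightarrow> bool" where
  "is_ntrans \<J> \<E> \<eta> \<longleftrightarrow>
     is_functor \<J> \<E> (nsrc \<eta>) \<and> is_functor \<J> \<E> (ntgt \<eta>) \<and>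
     at \<eta> \<in> extensional (Ob \<J>) \<and>
     (\<forall>j \<in> Ob \<J>. at \<eta> j \<in> hom \<E> (fob (nsrc \<eta>) j) (fob (ntgt \<eta>) j)) \<and>
     (\<forall>u \<in> Ar \<J>. cmp \<E> (at \<eta> (tgt \<J> u)) (far (nsrc \<eta>) u) =
                  cmp \<E> (far (ntgt \<eta>) u) (at \<eta> (src \<J> u)))"

definition functor_cat :: "('o1, 'm1) cat \<Rightarrow> ('o2, 'm2) cat \<Rightarrow>
    (('o1, 'm1, 'o2, 'm2) fctr, ('o1, 'm1, 'o2, 'm2) ntrans) cat" where
  "functor_cat \<J> \<E> = \<lparr>Ob = {F. is_functor \<J> \<E> F}, Ar = {\<eta>. is_ntrans \<J> \<E> \<eta>},
     src = nsrc, tgt = ntgt,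
     idt = (\<lambda>F. \<lparr>nsrc = F, ntgt = F, at = (\<lambda>j \<in> Ob \<J>. idt \<E> (fob F j))\<rparr>),
     cmp = (\<lambda>\<theta> \<eta>. \<lparr>nsrc = nsrc \<eta>, ntgt = ntgt \<theta>,
              at = (\<lambda>j \<in> Ob \<J>. cmp \<E> (at \<theta> j) (at \<eta> j))\<rparr>)\<rparr>"


section \<open>Internal categories\<close>

definition is_pullback ::
    "('o, 'm) cat \<Rightarrow> 'm \<Rightarrow> 'm \<Rightarrow> 'o \<Rightarrow> 'm \<Rightarrow> 'm \<Rightarrow> bool" where
  "is_pullback \<E> f g P p q \<longleftrightarrow>
     f \<in> Ar \<E> \<and> g \<in> Ar \<E> \<and> tgt \<E> f = tgt \<E> g \<and>
     P \<in> Ob \<E> \<and> p \<in> hom \<E> P (src \<E> f) \<and> q \<in> hom \<E> P (src \<E> g) \<and>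
     cmp \<E> f p = cmp \<E> g q \<and>
     (\<forall>T \<in> Ob \<E>. \<forall>u \<in> hom \<E> T (src \<E> f). \<forall>v \<in> hom \<E> T (src \<E> g).
        cmp \<E> f u = cmp \<E> g v \<longrightarrow>
        (\<exists>!h. h \<in> hom \<E> T P \<and> cmp \<E> p h = u \<and> cmp \<E> q h = v))"

text \<open>The arrow \<open>\<langle>u, v\<rangle>\<close> into a pullback with projections \<open>p\<close> and \<open>q\<close>.\<close>

definition pairing :: "('o, 'm) cat \<Rightarrow> 'm \<Rightarrow> 'm \<Rightarrow> 'm \<Rightarrow> 'm \<Rightarrow> 'm" where
  "pairing \<E> p q u v = (THE h. h \<in> hom \<E> (src \<E> u) (src \<E> p) \<and>
     cmp \<E> p h = u \<and> cmp \<E> q h = v)"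

text \<open>
  An internal category with object of objects \<open>X\<^sub>0\<close>, object of morphisms \<open>X\<^sub>1\<close>, domain \<open>d\<close>,
  codomain \<open>c\<close>, identities \<open>e\<close> and composition \<open>m\<close>.  The object \<open>P\<close> of composable pairs
  \<open>(x, x')\<close>, \<open>d x = c x'\<close>, with its projections \<open>p\<close> and \<open>p'\<close> is a chosen pullback, and \<open>m\<close> sends
  \<open>(x, x')\<close> to the composite ``first \<open>x'\<close>, then \<open>x\<close>''.  The object \<open>Q\<close> of composable triples
  \<open>((x, x'), x'')\<close> is any pullback; associativity does not depend on its choice.
\<close>

definition internal_category :: "('o, 'm) cat \<Rightarrow>
    'o \<Rightarrow> 'o \<Rightarrow> 'm \<Rightarrow> 'm \<Rightarrow> 'm \<Rightarrow> 'm \<Rightarrow> 'o \<Rightarrow> 'm \<Rightarrow> 'm \<Rightarrow> bool" where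
  "internal_category \<E> X\<^sub>0 X\<^sub>1 d c e m P p p' \<longleftrightarrow>
     (let comp = cmp \<E>; pair = pairing \<E> p p' in
       X\<^sub>0 \<in> Ob \<E> \<and> X\<^sub>1 \<in> Ob \<E> \<and>
       d \<in> hom \<E> X\<^sub>1 X\<^sub>0 \<and> c \<in> hom \<E> X\<^sub>1 X\<^sub>0 \<and> e \<in> hom \<E> X\<^sub>0 X\<^sub>1 \<and>
       is_pullback \<E> d c P p p' \<and> m \<in> hom \<E> P X\<^sub>1 \<and>
       comp d e = idt \<E> X\<^sub>0 \<and> comp c e = idt \<E> X\<^sub>0 \<and>
       comp d m = comp d p' \<and> comp c m = comp c p \<and>
       comp m (pair (comp e c) (idt \<E> X\<^sub>1)) = idt \<E> X\<^sub>1 \<and>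
       comp m (pair (idt \<E> X\<^sub>1) (comp e d)) = idt \<E> X\<^sub>1 \<and>
       (\<exists>Q q r. is_pullback \<E> (comp d p') c Q q r \<and>
          comp m (pair (comp p q) (comp m (pair (comp p' q) r))) =
          comp m (pair (comp m q) r)))"


section \<open>Sets and set-valued functors\<close>

datatype 'e fn = Fn (fsrc: "'e set") (app: "'e \<Rightarrow> 'e") (ftgt: "'e set")

definition set_cat :: "('e set, 'e fn) cat" where
  "set_cat = \<lparr>Ob = UNIV, Ar = {f. app f \<in> fsrc f \<rightarrow>\<^sub>E ftgt f}, src = fsrc, tgt = ftgt,
     idt = (\<lambda>X. Fn X (\<lambda>x \<in> X. x) X),
     cmp = (\<lambda>g f. Fn (fsrc f) (compose (fsrc f) (app g) (app f)) (ftgt g))\<rparr>"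

text \<open>
  The universe of elements of sets for a category with arrows of type \<open>'m\<close>.  It contains the arrows
  (so that the hom functor is set-valued), arbitrarily many further elements of a type \<open>'h\<close>
  that can be chosen at will, and is closed under ordered pairs (so that pullbacks
  consisting of pairs exist).
\<close>

datatype ('m, 'h) elt = Mor (the_mor: 'm) | Atom 'h | Pr (pr1: "('m, 'h) elt") (pr2: "('m, 'h) elt")

type_synonym ('j, 'k, 'm, 'h) set_fctr =
  "('j, 'k, ('m, 'h) elt set, ('m, 'h) elt fn) fctr"
type_synonym ('j, 'k, 'm, 'h) set_ntrans =
  "('j, 'k, ('m, 'h) elt set, ('m, 'h) elt fn) ntrans"

definition pb_set :: "('j, 'k, 'm, 'h) set_ntrans \<Rightarrow> ('j, 'k, 'm, 'h) set_ntrans \<Rightarrow>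
    'j \<Rightarrow> ('m, 'h) elt set" where
  "pb_set \<alpha> \<beta> j = {Pr x x' | x x'. x \<in> fob (nsrc \<alpha>) j \<and> x' \<in> fob (nsrc \<beta>) j \<and>
     app (at \<alpha> j) x = app (at \<beta> j) x'}"

definition pb_fctr :: "('j, 'k) cat \<Rightarrow>
    ('j, 'k, 'm, 'h) set_ntrans \<Rightarrow> ('j, 'k, 'm, 'h) set_ntrans \<Rightarrow> ('j, 'k, 'm, 'h) set_fctr" where
  "pb_fctr \<J> \<alpha> \<beta> = \<lparr>fob = (\<lambda>j \<in> Ob \<J>. pb_set \<alpha> \<beta> j),
     far = (\<lambda>u \<in> Ar \<J>. Fn (pb_set \<alpha> \<beta> (src \<J> u))
       (\<lambda>z \<in> pb_set \<alpha> \<beta> (src \<J> u).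
          Pr (app (far (nsrc \<alpha>) u) (pr1 z)) (app (far (nsrc \<beta>) u) (pr2 z)))
       (pb_set \<alpha> \<beta> (tgt \<J> u)))\<rparr>"

definition pb_proj1 :: "('j, 'k) cat \<Rightarrow>
    ('j, 'k, 'm, 'h) set_ntrans \<Rightarrow> ('j, 'k, 'm, 'h) set_ntrans \<Rightarrow> ('j, 'k, 'm, 'h) set_ntrans" where
  "pb_proj1 \<J> \<alpha> \<beta> = \<lparr>nsrc = pb_fctr \<J> \<alpha> \<beta>, ntgt = nsrc \<alpha>,
     at = (\<lambda>j \<in> Ob \<J>. Fn (pb_set \<alpha> \<beta> j) (\<lambda>z \<in> pb_set \<alpha> \<beta> j. pr1 z) (fob (nsrc \<alpha>) j))\<rparr>"

definition pb_proj2 :: "('j, 'k) cat \<Rightarrow>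
    ('j, 'k, 'm, 'h) set_ntrans \<Rightarrow> ('j, 'k, 'm, 'h) set_ntrans \<Rightarrow> ('j, 'k, 'm, 'h) set_ntrans" where
  "pb_proj2 \<J> \<alpha> \<beta> = \<lparr>nsrc = pb_fctr \<J> \<alpha> \<beta>, ntgt = nsrc \<beta>,
     at = (\<lambda>j \<in> Ob \<J>. Fn (pb_set \<alpha> \<beta> j) (\<lambda>z \<in> pb_set \<alpha> \<beta> j. pr2 z) (fob (nsrc \<beta>) j))\<rparr>"


section \<open>2-cell structures\<close>

type_synonym ('o, 'm, 'h) bifctr = "('o \<times> 'o, 'm \<times> 'm, 'm, 'h) set_fctr"
type_synonym ('o, 'm, 'h) bintrans = "('o \<times> 'o, 'm \<times> 'm, 'm, 'h) set_ntrans"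

abbreviation op_prod :: "('o, 'm) cat \<Rightarrow> ('o \<times> 'o, 'm \<times> 'm) cat" where
  "op_prod \<C> \<equiv> prod_cat (op_cat \<C>) \<C>"

definition hom_fctr :: "('o, 'm) cat \<Rightarrow> ('o, 'm, 'h) bifctr" where
  "hom_fctr \<C> = \<lparr>fob = (\<lambda>(A, B) \<in> Ob \<C> \<times> Ob \<C>. Mor ` hom \<C> A B),
     far = (\<lambda>(f, g) \<in> Ar \<C> \<times> Ar \<C>.
       Fn (Mor ` hom \<C> (tgt \<C> f) (src \<C> g))
          (\<lambda>h \<in> Mor ` hom \<C> (tgt \<C> f) (src \<C> g). Mor (cmp \<C> (cmp \<C> g (the_mor h)) f))
          (Mor ` hom \<C> (src \<C> f) (tgt \<C> g)))\<rparr>"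

type_synonym ('o, 'm, 'h) two_cell_struct =
  "('o, 'm, 'h) bifctr \<times> ('o, 'm, 'h) bintrans \<times> ('o, 'm, 'h) bintrans \<times>
   ('o, 'm, 'h) bintrans \<times> ('o, 'm, 'h) bintrans"

definition two_cell_structures :: "('o, 'm) cat \<Rightarrow> ('o, 'm, 'h) two_cell_struct set" where
  "two_cell_structures \<C> = {(H, cdom, ccod, zero, plus).
     internal_category (functor_cat (op_prod \<C>) set_cat) (hom_fctr \<C>) H cdom ccod zero plus
       (pb_fctr (op_prod \<C>) cdom ccod)
       (pb_proj1 (op_prod \<C>) cdom ccod) (pb_proj2 (op_prod \<C>) cdom ccod)}"


section \<open>Two-sided actions\<close>

text \<open>
  The sets \<open>H A B\<close> need not be disjoint, so all maps are indexed by the objects involved: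
  \<open>ract A B C (x, f)\<close> is \<open>x f\<close> for \<open>x\<close> in \<open>H B C\<close> and \<open>f : A \<rightarrow> B\<close>, and \<open>lact A B C (g, y)\<close> is
  \<open>g y\<close> for \<open>g : B \<rightarrow> C\<close> and \<open>y\<close> in \<open>H A B\<close>.
\<close>

definition composable :: "('o \<Rightarrow> 'o \<Rightarrow> 'e set) \<Rightarrow>
    ('o \<Rightarrow> 'o \<Rightarrow> 'e \<Rightarrow> 'm) \<Rightarrow> ('o \<Rightarrow> 'o \<Rightarrow> 'e \<Rightarrow> 'm) \<Rightarrow> 'o \<Rightarrow> 'o \<Rightarrow> ('e \<times> 'e) set" where
  "composable H cdom ccod A B = {(x, x') \<in> H A B \<times> H A B. cdom A B x = ccod A B x'}"

locale two_cell_actions = category \<C> for \<C> :: "('o, 'm) cat" (structure) +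
  fixes H :: "'o \<Rightarrow> 'o \<Rightarrow> 'e set"
    and cdom ccod :: "'o \<Rightarrow> 'o \<Rightarrow> 'e \<Rightarrow> 'm"
    and zero :: "'o \<Rightarrow> 'o \<Rightarrow> 'm \<Rightarrow> 'e"
    and plus :: "'o \<Rightarrow> 'o \<Rightarrow> 'e \<times> 'e \<Rightarrow> 'e"
    and ract :: "'o \<Rightarrow> 'o \<Rightarrow> 'o \<Rightarrow> 'e \<times> 'm \<Rightarrow> 'e"
    and lact :: "'o \<Rightarrow> 'o \<Rightarrow> 'o \<Rightarrow> 'm \<times> 'e \<Rightarrow> 'e"
  assumes H_type: "H \<in> Ob \<C> \<rightarrow>\<^sub>E Ob \<C> \<rightarrow>\<^sub>E UNIV"
    and cdom_type: "cdom \<in> (\<Pi>\<^sub>E A \<in> Ob \<C>. \<Pi>\<^sub>E B \<in> Ob \<C>. H A B \<rightarrow>\<^sub>E hom \<C> A B)"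
    and ccod_type: "ccod \<in> (\<Pi>\<^sub>E A \<in> Ob \<C>. \<Pi>\<^sub>E B \<in> Ob \<C>. H A B \<rightarrow>\<^sub>E hom \<C> A B)"
    and zero_type: "zero \<in> (\<Pi>\<^sub>E A \<in> Ob \<C>. \<Pi>\<^sub>E B \<in> Ob \<C>. hom \<C> A B \<rightarrow>\<^sub>E H A B)"
    and plus_type:
      "plus \<in> (\<Pi>\<^sub>E A \<in> Ob \<C>. \<Pi>\<^sub>E B \<in> Ob \<C>. composable H cdom ccod A B \<rightarrow>\<^sub>E H A B)"
    and ract_type: "ract \<in> (\<Pi>\<^sub>E A \<in> Ob \<C>. \<Pi>\<^sub>E B \<in> Ob \<C>. \<Pi>\<^sub>E C \<in> Ob \<C>.
      H B C \<times> hom \<C> A B \<rightarrow>\<^sub>E H A C)"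
    and lact_type: "lact \<in> (\<Pi>\<^sub>E A \<in> Ob \<C>. \<Pi>\<^sub>E B \<in> Ob \<C>. \<Pi>\<^sub>E C \<in> Ob \<C>.
      hom \<C> B C \<times> H A B \<rightarrow>\<^sub>E H A C)"

    and cdom_lact: "\<lbrakk>A \<in> Ob \<C>; B \<in> Ob \<C>; C \<in> Ob \<C>; g \<in> hom \<C> B C; y \<in> H A B\<rbrakk>
      \<Longrightarrow> cdom A C (lact A B C (g, y)) = g \<cdot> cdom A B y"
    and cdom_ract: "\<lbrakk>A \<in> Ob \<C>; B \<in> Ob \<C>; C \<in> Ob \<C>; x \<in> H B C; f \<in> hom \<C> A B\<rbrakk>
      \<Longrightarrow> cdom A C (ract A B C (x, f)) = cdom B C x \<cdot> f"
    and ccod_lact: "\<lbrakk>A \<in> Ob \<C>; B \<in> Ob \<C>; C \<in> Ob \<C>; g \<in> hom \<C> B C; y \<in> H A B\<rbrakk>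
      \<Longrightarrow> ccod A C (lact A B C (g, y)) = g \<cdot> ccod A B y"
    and ccod_ract: "\<lbrakk>A \<in> Ob \<C>; B \<in> Ob \<C>; C \<in> Ob \<C>; x \<in> H B C; f \<in> hom \<C> A B\<rbrakk>
      \<Longrightarrow> ccod A C (ract A B C (x, f)) = ccod B C x \<cdot> f"
    and lact_zero: "\<lbrakk>A \<in> Ob \<C>; B \<in> Ob \<C>; C \<in> Ob \<C>; g \<in> hom \<C> B C; f \<in> hom \<C> A B\<rbrakk>
      \<Longrightarrow> lact A B C (g, zero A B f) = zero A C (g \<cdot> f)"
    and ract_zero: "\<lbrakk>A \<in> Ob \<C>; B \<in> Ob \<C>; C \<in> Ob \<C>; g \<in> hom \<C> B C; f \<in> hom \<C> A B\<rbrakk>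
      \<Longrightarrow> zero A C (g \<cdot> f) = ract A B C (zero B C g, f)"
    and ract_plus: "\<lbrakk>A \<in> Ob \<C>; B \<in> Ob \<C>; C \<in> Ob \<C>;
        (x, x') \<in> composable H cdom ccod B C; f \<in> hom \<C> A B\<rbrakk>
      \<Longrightarrow> ract A B C (plus B C (x, x'), f) =
        plus A C (ract A B C (x, f), ract A B C (x', f))"
    and lact_plus: "\<lbrakk>A \<in> Ob \<C>; B \<in> Ob \<C>; C \<in> Ob \<C>;
        g \<in> hom \<C> B C; (y, y') \<in> composable H cdom ccod A B\<rbrakk>
      \<Longrightarrow> lact A B C (g, plus A B (y, y')) =
        plus A C (lact A B C (g, y), lact A B C (g, y'))"

    and lact_lact: "\<lbrakk>A \<in> Ob \<C>; B \<in> Ob \<C>; C \<in> Ob \<C>; D \<in> Ob \<C>;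
        g' \<in> hom \<C> C D; g \<in> hom \<C> B C; y \<in> H A B\<rbrakk>
      \<Longrightarrow> lact A C D (g', lact A B C (g, y)) = lact A B D (g' \<cdot> g, y)"
    and ract_ract: "\<lbrakk>A \<in> Ob \<C>; B \<in> Ob \<C>; C \<in> Ob \<C>; D \<in> Ob \<C>;
        x \<in> H C D; f \<in> hom \<C> B C; f' \<in> hom \<C> A B\<rbrakk>
      \<Longrightarrow> ract A B D (ract B C D (x, f), f') = ract A C D (x, f \<cdot> f')"
    and lact_ract: "\<lbrakk>A \<in> Ob \<C>; B \<in> Ob \<C>; C \<in> Ob \<C>; D \<in> Ob \<C>;
        g' \<in> hom \<C> C D; x \<in> H B C; f \<in> hom \<C> A B\<rbrakk>
      \<Longrightarrow> lact A C D (g', ract A B C (x, f)) = ract A B D (lact B C D (g', x), f)"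
    and lact_idt: "\<lbrakk>B \<in> Ob \<C>; C \<in> Ob \<C>; x \<in> H B C\<rbrakk> \<Longrightarrow> lact B C C (\<one> C, x) = x"
    and ract_idt: "\<lbrakk>B \<in> Ob \<C>; C \<in> Ob \<C>; x \<in> H B C\<rbrakk> \<Longrightarrow> ract B B C (x, \<one> B) = x"

    and cdom_zero: "\<lbrakk>A \<in> Ob \<C>; B \<in> Ob \<C>; f \<in> hom \<C> A B\<rbrakk> \<Longrightarrow> cdom A B (zero A B f) = f"
    and ccod_zero: "\<lbrakk>A \<in> Ob \<C>; B \<in> Ob \<C>; f \<in> hom \<C> A B\<rbrakk> \<Longrightarrow> ccod A B (zero A B f) = f"
    and cdom_plus: "\<lbrakk>A \<in> Ob \<C>; B \<in> Ob \<C>; (x, x') \<in> composable H cdom ccod A B\<rbrakk>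
      \<Longrightarrow> cdom A B (plus A B (x, x')) = cdom A B x'"
    and ccod_plus: "\<lbrakk>A \<in> Ob \<C>; B \<in> Ob \<C>; (x, x') \<in> composable H cdom ccod A B\<rbrakk>
      \<Longrightarrow> ccod A B (plus A B (x, x')) = ccod A B x"
    and zero_plus: "\<lbrakk>A \<in> Ob \<C>; B \<in> Ob \<C>; x \<in> H A B\<rbrakk>
      \<Longrightarrow> plus A B (zero A B (ccod A B x), x) = x"
    and plus_zero: "\<lbrakk>A \<in> Ob \<C>; B \<in> Ob \<C>; x \<in> H A B\<rbrakk>
      \<Longrightarrow> plus A B (x, zero A B (cdom A B x)) = x"
    and plus_assoc: "\<lbrakk>A \<in> Ob \<C>; B \<in> Ob \<C>; (x, x') \<in> composable H cdom ccod A B;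
        (x', x'') \<in> composable H cdom ccod A B\<rbrakk>
      \<Longrightarrow> plus A B (x, plus A B (x', x'')) = plus A B (plus A B (x, x'), x'')"

type_synonym ('o, 'm, 'e) action_data =
  "('o \<Rightarrow> 'o \<Rightarrow> 'e set) \<times>
   ('o \<Rightarrow> 'o \<Rightarrow> 'e \<Rightarrow> 'm) \<times> ('o \<Rightarrow> 'o \<Rightarrow> 'e \<Rightarrow> 'm) \<times>
   ('o \<Rightarrow> 'o \<Rightarrow> 'm \<Rightarrow> 'e) \<times> ('o \<Rightarrow> 'o \<Rightarrow> 'e \<times> 'e \<Rightarrow> 'e) \<times>
   ('o \<Rightarrow> 'o \<Rightarrow> 'o \<Rightarrow> 'e \<times> 'm \<Rightarrow> 'e) \<times> ('o \<Rightarrow> 'o \<Rightarrow> 'o \<Rightarrow> 'm \<times> 'e \<Rightarrow> 'e)"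

definition action_structures :: "('o, 'm) cat \<Rightarrow> ('o, 'm, 'e) action_data set" where
  "action_structures \<C> = {(H, cdom, ccod, zero, plus, ract, lact).
     two_cell_actions \<C> H cdom ccod zero plus ract lact}"

text \<open>
  The data given by a 2-cell structure: its values and components at the pairs \<open>(A, B)\<close>, with
  actions \<open>x f = H(f, 1)(x)\<close> and \<open>g y = H(1, g)(y)\<close>.
\<close>

definition action_data_of ::
    "('o, 'm) cat \<Rightarrow> ('o, 'm, 'h) two_cell_struct \<Rightarrow> ('o, 'm, ('m, 'h) elt) action_data" where
  "action_data_of \<C> = (\<lambda>(H, cdom, ccod, zero, plus).
     (\<lambda>A \<in> Ob \<C>. \<lambda>B \<in> Ob \<C>. fob H (A, B),
      \<lambda>A \<in> Ob \<C>. \<lambda>B \<in> Ob \<C>. \<lambda>x \<in> fob H (A, B). the_mor (app (at cdom (A, B)) x),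
      \<lambda>A \<in> Ob \<C>. \<lambda>B \<in> Ob \<C>. \<lambda>x \<in> fob H (A, B). the_mor (app (at ccod (A, B)) x),
      \<lambda>A \<in> Ob \<C>. \<lambda>B \<in> Ob \<C>. \<lambda>f \<in> hom \<C> A B. app (at zero (A, B)) (Mor f),
      \<lambda>A \<in> Ob \<C>. \<lambda>B \<in> Ob \<C>.
        \<lambda>(x, x') \<in> {(x, x') \<in> fob H (A, B) \<times> fob H (A, B).
                      app (at cdom (A, B)) x = app (at ccod (A, B)) x'}.
          app (at plus (A, B)) (Pr x x'),
      \<lambda>A \<in> Ob \<C>. \<lambda>B \<in> Ob \<C>. \<lambda>C \<in> Ob \<C>. \<lambda>(x, f) \<in> fob H (B, C) \<times> hom \<C> A B.
        app (far H (f, idt \<C> C)) x,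
      \<lambda>A \<in> Ob \<C>. \<lambda>B \<in> Ob \<C>. \<lambda>C \<in> Ob \<C>. \<lambda>(g, y) \<in> hom \<C> B C \<times> fob H (A, B).
        app (far H (idt \<C> A, g)) y))"

end

theory Submission
  imports Defs
begin

text \<open>
  Limits and equations in a category of set-valued functors are computed fibrewise, so a 2-cell
  structure is a set-valued bifunctor \<open>H\<close> with natural families of category structures on the
  fibres \<open>H(A, B)\<close> over \<open>hom(A, B)\<close>.  A bifunctor amounts to two commuting one-sided actions
  through \<open>H(f, g)(x) = g (x f)\<close>, and under this correspondence naturality in each variable
  separately is condition (1), functoriality is (2), and the fibrewise category laws are (3).
\<close>

section \<open>Set-valued functors and their transformations, elementwise\<close>

text \<open>The correspondence is a bijection on the nose. This is possible because every family on
  either side is \<open>undefined\<close> outside its domain, and because the values of a bifunctor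
  and the sets of an action structure lie in the same universe \<open>elt\<close>. The price is a
  constant translation between arrows tagged by \<open>Mor\<close> and plain arrows, and between
  \<open>Pr x x'\<close> and \<open>(x, x')\<close>. On the functor side the obstacle is that
  \<open>pairing\<close> is a definite description and that the object of composable triples is an
  arbitrary pullback. The canonical pullback of pairs makes both accessible: the values of
  \<open>pairing\<close> are computed in it, and as a test object it reaches all elements of any
  other pullback. The laws also depend on each other. A pairing is meaningful only for composable
  arguments, so the unit laws can be read elementwise only after d e = 1 and c e = 1, and
  associativity only after the boundary laws for m.\<close>

lemma set_cat_simps [simp]:
  "Ob set_cat = UNIV" "src set_cat = fsrc" "tgt set_cat = ftgt"
  "idt set_cat X = Fn X (\<lambda>x \<in> X. x) X"
  "cmp set_cat g f = Fn (fsrc f) (compose (fsrc f) (app g) (app f)) (ftgt g)"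
  "f \<in> Ar set_cat \<longleftrightarrow> app f \<in> fsrc f \<rightarrow>\<^sub>E ftgt f"
  by (simp_all add: set_cat_def)

lemma in_hom_set_cat:
  "f \<in> hom set_cat X Y \<longleftrightarrow> fsrc f = X \<and> ftgt f = Y \<and> app f \<in> X \<rightarrow>\<^sub>E Y"
  by (auto simp: hom_def)

lemma functor_cat_simps [simp]:
  "F \<in> Ob (functor_cat \<J> \<E>) \<longleftrightarrow> is_functor \<J> \<E> F"
  "\<eta> \<in> Ar (functor_cat \<J> \<E>) \<longleftrightarrow> is_ntrans \<J> \<E> \<eta>"
  "src (functor_cat \<J> \<E>) = nsrc" "tgt (functor_cat \<J> \<E>) = ntgt"
  "nsrc (cmp (functor_cat \<J> \<E>) \<theta> \<eta>) = nsrc \<eta>"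
  "ntgt (cmp (functor_cat \<J> \<E>) \<theta> \<eta>) = ntgt \<theta>"
  "nsrc (idt (functor_cat \<J> \<E>) F) = F"
  "ntgt (idt (functor_cat \<J> \<E>) F) = F"
  by (simp_all add: functor_cat_def)

lemma in_hom_functor_cat:
  "\<eta> \<in> hom (functor_cat \<J> \<E>) F G \<longleftrightarrow> is_ntrans \<J> \<E> \<eta> \<and> nsrc \<eta> = F \<and> ntgt \<eta> = G"
  by (simp add: hom_def)

text \<open>Underlying functions are extensional on their source, so agreement on elements of X
  fixes them; the source and target sets are fixed by the hom set.\<close>

lemma fn_eqI:
  assumes "f \<in> hom set_cat X Y" "g \<in> hom set_cat X Y" "\<And>x. x \<in> X \<Longrightarrow> app f x = app g x"
  shows "f = g"
proof -
  have "app f = app g"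
    using assms by (intro extensionalityI[of _ X]) (auto simp: in_hom_set_cat PiE_def)
  then show ?thesis
    using assms by (auto simp: in_hom_set_cat intro: fn.expand)
qed

lemma cmp_hom_set_cat:
  "\<lbrakk>f \<in> hom set_cat X Y; g \<in> hom set_cat Y Z\<rbrakk> \<Longrightarrow> cmp set_cat g f \<in> hom set_cat X Z"
  by (auto simp: in_hom_set_cat compose_def)

lemma app_idt_functor_cat [simp]:
  "\<lbrakk>j \<in> Ob \<J>; x \<in> fob F j\<rbrakk> \<Longrightarrow> app (at (idt (functor_cat \<J> set_cat) F) j) x = x"
  by (simp add: functor_cat_def)

lemma set_functor_far_hom:
  "\<lbrakk>is_functor \<J> set_cat F; u \<in> Ar \<J>\<rbrakk>
    \<Longrightarrow> far F u \<in> hom set_cat (fob F (src \<J> u)) (fob F (tgt \<J> u))"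
  by (simp add: is_functor_def)

lemma set_functor_far_mem:
  "\<lbrakk>is_functor \<J> set_cat F; u \<in> Ar \<J>; x \<in> fob F (src \<J> u)\<rbrakk>
    \<Longrightarrow> app (far F u) x \<in> fob F (tgt \<J> u)"
  using set_functor_far_hom by (fastforce simp: in_hom_set_cat)

lemma set_functor_far_idt:
  "\<lbrakk>is_functor \<J> set_cat F; j \<in> Ob \<J>; x \<in> fob F j\<rbrakk> \<Longrightarrow> app (far F (idt \<J> j)) x = x"
  by (simp add: is_functor_def)

lemma set_functor_far_cmp:
  assumes "is_functor \<J> set_cat F" "u \<in> Ar \<J>" "v \<in> Ar \<J>" "tgt \<J> u = src \<J> v"
    "x \<in> fob F (src \<J> u)"
  shows "app (far F (cmp \<J> v u)) x = app (far F v) (app (far F u) x)"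
proof -
  have "far F (cmp \<J> v u) = cmp set_cat (far F v) (far F u)"
    using assms by (simp add: is_functor_def del: set_cat_simps)
  then show ?thesis
    using set_functor_far_hom[OF assms(1,2)] assms(5) by (simp add: in_hom_set_cat compose_def)
qed

lemma set_functor_eqI:
  fixes F G :: "('j, 'k, 'e set, 'e fn) fctr"
  assumes F: "is_functor \<J> set_cat F" and G: "is_functor \<J> set_cat G"
    and ob: "\<And>j. j \<in> Ob \<J> \<Longrightarrow> fob F j = fob G j"
    and J: "category \<J>"
    and ar: "\<And>u x. \<lbrakk>u \<in> Ar \<J>; x \<in> fob F (src \<J> u)\<rbrakk> \<Longrightarrow> app (far F u) x = app (far G u) x"
  shows "F = G"
proof -
  have "fob F = fob G"
    using F G ob by (intro extensionalityI[of _ "Ob \<J>"]) (auto simp: is_functor_def PiE_def)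
  moreover have "far F = far G"
  proof (rule extensionalityI[of _ "Ar \<J>"])
    fix u assume u: "u \<in> Ar \<J>"
    show "far F u = far G u"
      using set_functor_far_hom[OF F u] set_functor_far_hom[OF G u] ar[OF u]
      unfolding \<open>fob F = fob G\<close> by (rule fn_eqI)
  qed (use F G in \<open>auto simp: is_functor_def\<close>)
  ultimately show ?thesis by simp
qed

lemma set_ntrans_at_hom:
  "\<lbrakk>is_ntrans \<J> set_cat \<eta>; j \<in> Ob \<J>\<rbrakk>
    \<Longrightarrow> at \<eta> j \<in> hom set_cat (fob (nsrc \<eta>) j) (fob (ntgt \<eta>) j)"
  by (simp add: is_ntrans_def)

lemma set_ntrans_at_mem:
  "\<lbrakk>is_ntrans \<J> set_cat \<eta>; j \<in> Ob \<J>; x \<in> fob (nsrc \<eta>) j\<rbrakk>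
    \<Longrightarrow> app (at \<eta> j) x \<in> fob (ntgt \<eta>) j"
  using set_ntrans_at_hom by (fastforce simp: in_hom_set_cat)

lemma hom_functor_cat_at_mem:
  "\<lbrakk>\<eta> \<in> hom (functor_cat \<J> set_cat) F G; j \<in> Ob \<J>; x \<in> fob F j\<rbrakk>
    \<Longrightarrow> app (at \<eta> j) x \<in> fob G j"
  using set_ntrans_at_mem by (fastforce simp: in_hom_functor_cat)

lemma set_ntrans_eqI:
  fixes \<eta> \<theta> :: "('j, 'k, 'e set, 'e fn) ntrans"
  assumes "\<eta> \<in> hom (functor_cat \<J> set_cat) F G" "\<theta> \<in> hom (functor_cat \<J> set_cat) F G"
    and eq: "\<And>j x. \<lbrakk>j \<in> Ob \<J>; x \<in> fob F j\<rbrakk> \<Longrightarrow> app (at \<eta> j) x = app (at \<theta> j) x"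
  shows "\<eta> = \<theta>"
proof -
  have *: "is_ntrans \<J> set_cat \<eta>" "nsrc \<eta> = F" "ntgt \<eta> = G"
    "is_ntrans \<J> set_cat \<theta>" "nsrc \<theta> = F" "ntgt \<theta> = G"
    using assms by (auto simp: in_hom_functor_cat)
  have "at \<eta> = at \<theta>"
  proof (rule extensionalityI[of _ "Ob \<J>"])
    fix j assume j: "j \<in> Ob \<J>"
    show "at \<eta> j = at \<theta> j"
      using set_ntrans_at_hom[OF *(1) j] set_ntrans_at_hom[OF *(4) j] eq[OF j]
      unfolding * by (rule fn_eqI)
  qed (use * in \<open>auto simp: is_ntrans_def\<close>)
  with * show ?thesis by simp
qed

text \<open>Every axiom of an internal category is an equation between parallel transformations;
  this equivalence is how each of them is read on elements.\<close>

lemma hom_functor_cat_eq_iff: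
  fixes \<eta> \<theta> :: "('j, 'k, 'e set, 'e fn) ntrans"
  assumes "\<eta> \<in> hom (functor_cat \<J> set_cat) F G" "\<theta> \<in> hom (functor_cat \<J> set_cat) F G"
  shows "\<eta> = \<theta> \<longleftrightarrow> (\<forall>j \<in> Ob \<J>. \<forall>x \<in> fob F j. app (at \<eta> j) x = app (at \<theta> j) x)"
  using set_ntrans_eqI[OF assms] by blast

text \<open>Only the inner transformation has to be typed: a composite in \<open>set_cat\<close> is
  restricted to the source of the map applied first.\<close>

lemma app_cmp_functor_cat:
  assumes "\<eta> \<in> hom (functor_cat \<J> set_cat) F G" "j \<in> Ob \<J>" "x \<in> fob F j"
  shows "app (at (cmp (functor_cat \<J> set_cat) \<theta> \<eta>) j) x = app (at \<theta> j) (app (at \<eta> j) x)"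
proof -
  have "fsrc (at \<eta> j) = fob F j"
    using assms set_ntrans_at_hom by (fastforce simp: in_hom_set_cat in_hom_functor_cat)
  then show ?thesis
    using assms by (simp add: functor_cat_def compose_def)
qed

section \<open>Functors and transformations built from elementwise data\<close>

text \<open>The restrictions supply the extensionality that \<open>is_functor\<close> demands, so
  that functoriality becomes a statement about elements. The pullback functor, the hom functor and
  the functor built from actions all have this form.\<close>

definition set_fctr_of ::
    "('j, 'k) cat \<Rightarrow> ('j \<Rightarrow> 'e set) \<Rightarrow> ('k \<Rightarrow> 'e \<Rightarrow> 'e) \<Rightarrow> ('j, 'k, 'e set, 'e fn) fctr" where
  "set_fctr_of \<J> S a = \<lparr>fob = (\<lambda>j \<in> Ob \<J>. S j),
     far = (\<lambda>u \<in> Ar \<J>. Fn (S (src \<J> u)) (\<lambda>x \<in> S (src \<J> u). a u x) (S (tgt \<J> u)))\<rparr>"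

definition set_ntrans_of ::
    "('j, 'k) cat \<Rightarrow> ('j, 'k, 'e set, 'e fn) fctr \<Rightarrow> ('j, 'k, 'e set, 'e fn) fctr \<Rightarrow>
     ('j \<Rightarrow> 'e \<Rightarrow> 'e) \<Rightarrow> ('j, 'k, 'e set, 'e fn) ntrans" where
  "set_ntrans_of \<J> F G t = \<lparr>nsrc = F, ntgt = G,
     at = (\<lambda>j \<in> Ob \<J>. Fn (fob F j) (\<lambda>x \<in> fob F j. t j x) (fob G j))\<rparr>"

lemma fob_set_fctr_of [simp]: "j \<in> Ob \<J> \<Longrightarrow> fob (set_fctr_of \<J> S a) j = S j"
  by (simp add: set_fctr_of_def)

lemma app_far_set_fctr_of [simp]:
  "\<lbrakk>u \<in> Ar \<J>; x \<in> S (src \<J> u)\<rbrakk> \<Longrightarrow> app (far (set_fctr_of \<J> S a) u) x = a u x"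
  by (simp add: set_fctr_of_def)

lemma set_ntrans_of_simps [simp]:
  "nsrc (set_ntrans_of \<J> F G t) = F" "ntgt (set_ntrans_of \<J> F G t) = G"
  "\<lbrakk>j \<in> Ob \<J>; x \<in> fob F j\<rbrakk> \<Longrightarrow> app (at (set_ntrans_of \<J> F G t) j) x = t j x"
  by (simp_all add: set_ntrans_of_def)

section \<open>Pairings and the pullback of pairs\<close>

text \<open>\<open>pairing\<close> picks its value with \<open>THE\<close>, so the existence and the
  uniqueness in the universal property are both needed before anything is known about it.\<close>

lemma pairing_pullback:
  assumes pb: "is_pullback \<E> f g P p q" and T: "T \<in> Ob \<E>"
    and u: "u \<in> hom \<E> T (src \<E> f)" and v: "v \<in> hom \<E> T (src \<E> g)" and eq: "cmp \<E> f u = cmp \<E> g v"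
  shows "pairing \<E> p q u v \<in> hom \<E> T P" "cmp \<E> p (pairing \<E> p q u v) = u"
    "cmp \<E> q (pairing \<E> p q u v) = v"
proof -
  have "\<exists>!h. h \<in> hom \<E> T P \<and> cmp \<E> p h = u \<and> cmp \<E> q h = v"
    using assms unfolding is_pullback_def by blast
  moreover have "src \<E> u = T" "src \<E> p = P"
    using pb u by (auto simp: is_pullback_def hom_def)
  ultimately have "\<exists>!h. h \<in> hom \<E> (src \<E> u) (src \<E> p) \<and> cmp \<E> p h = u \<and> cmp \<E> q h = v"
    by simp
  from theI'[OF this] show "pairing \<E> p q u v \<in> hom \<E> T P"
    "cmp \<E> p (pairing \<E> p q u v) = u" "cmp \<E> q (pairing \<E> p q u v) = v"
    by (simp_all add: pairing_def \<open>src \<E> u = T\<close> \<open>src \<E> p = P\<close>)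
qed

lemma pb_fctr_eq: "pb_fctr \<J> \<alpha> \<beta> = set_fctr_of \<J> (pb_set \<alpha> \<beta>)
    (\<lambda>u z. Pr (app (far (nsrc \<alpha>) u) (pr1 z)) (app (far (nsrc \<beta>) u) (pr2 z)))"
  by (simp add: pb_fctr_def set_fctr_of_def)

lemma fob_pb_fctr [simp]: "j \<in> Ob \<J> \<Longrightarrow> fob (pb_fctr \<J> \<alpha> \<beta>) j = pb_set \<alpha> \<beta> j"
  by (simp add: pb_fctr_eq)

lemma app_far_pb_fctr [simp]:
  "\<lbrakk>u \<in> Ar \<J>; z \<in> pb_set \<alpha> \<beta> (src \<J> u)\<rbrakk> \<Longrightarrow> app (far (pb_fctr \<J> \<alpha> \<beta>) u) z =
    Pr (app (far (nsrc \<alpha>) u) (pr1 z)) (app (far (nsrc \<beta>) u) (pr2 z))"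
  by (simp add: pb_fctr_eq)

lemma pb_proj1_eq: "pb_proj1 \<J> \<alpha> \<beta> = set_ntrans_of \<J> (pb_fctr \<J> \<alpha> \<beta>) (nsrc \<alpha>) (\<lambda>j. pr1)"
  and pb_proj2_eq: "pb_proj2 \<J> \<alpha> \<beta> = set_ntrans_of \<J> (pb_fctr \<J> \<alpha> \<beta>) (nsrc \<beta>) (\<lambda>j. pr2)"
  by (auto simp: pb_proj1_def pb_proj2_def set_ntrans_of_def intro!: restrict_ext)

lemma app_pb_proj [simp]:
  assumes "j \<in> Ob \<J>" "z \<in> pb_set \<alpha> \<beta> j"
  shows "app (at (pb_proj1 \<J> \<alpha> \<beta>) j) z = pr1 z" "app (at (pb_proj2 \<J> \<alpha> \<beta>) j) z = pr2 z"
  using assms by (simp_all add: pb_proj1_eq pb_proj2_eq)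

section \<open>Functoriality, naturality and composition on elements\<close>

text \<open>A copy of \<open>category\<close> under another name: facts about the index category,
  later \<open>op_prod \<C>\<close>, stay apart from facts about \<C> itself.\<close>

locale diagram_shape = category \<J> for \<J> :: "('j, 'k) cat"
begin

lemma idt_Ar:
  assumes "j \<in> Ob \<J>"
  shows "idt \<J> j \<in> Ar \<J>" "src \<J> (idt \<J> j) = j" "tgt \<J> (idt \<J> j) = j"
  using idt_hom[OF assms] by (auto simp: hom_def)

lemma cmp_Ar:
  assumes "u \<in> Ar \<J>" "v \<in> Ar \<J>" "tgt \<J> u = src \<J> v"
  shows "cmp \<J> v u \<in> Ar \<J>" "src \<J> (cmp \<J> v u) = src \<J> u" "tgt \<J> (cmp \<J> v u) = tgt \<J> v"
  using cmp_hom[of u "src \<J> u" "tgt \<J> u" v "tgt \<J> v"] assms by (auto simp: hom_def)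

lemma is_functor_set_fctr_of:
  fixes S :: "'j \<Rightarrow> 'e set"
  assumes mem: "\<And>u x. \<lbrakk>u \<in> Ar \<J>; x \<in> S (src \<J> u)\<rbrakk> \<Longrightarrow> a u x \<in> S (tgt \<J> u)"
    and idt: "\<And>j x. \<lbrakk>j \<in> Ob \<J>; x \<in> S j\<rbrakk> \<Longrightarrow> a (idt \<J> j) x = x"
    and cmp: "\<And>u v x. \<lbrakk>u \<in> Ar \<J>; v \<in> Ar \<J>; tgt \<J> u = src \<J> v; x \<in> S (src \<J> u)\<rbrakk>
      \<Longrightarrow> a (cmp \<J> v u) x = a v (a u x)"
  shows "is_functor \<J> set_cat (set_fctr_of \<J> S a)"
  unfolding is_functor_def
proof (intro conjI ballI impI)
  show "fob (set_fctr_of \<J> S a) \<in> Ob \<J> \<rightarrow>\<^sub>E Ob set_cat"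
    "far (set_fctr_of \<J> S a) \<in> extensional (Ar \<J>)"
    by (simp_all add: set_fctr_of_def)
next
  fix u assume "u \<in> Ar \<J>"
  then show "far (set_fctr_of \<J> S a) u \<in> hom set_cat (fob (set_fctr_of \<J> S a) (src \<J> u))
      (fob (set_fctr_of \<J> S a) (tgt \<J> u))"
    by (simp add: in_hom_set_cat set_fctr_of_def src_Ob tgt_Ob mem)
next
  fix j assume j: "j \<in> Ob \<J>"
  then show "far (set_fctr_of \<J> S a) (idt \<J> j) = idt set_cat (fob (set_fctr_of \<J> S a) j)"
    by (auto simp: set_fctr_of_def idt_Ar idt intro!: restrict_ext)
next
  fix u v assume uv: "u \<in> Ar \<J>" "v \<in> Ar \<J>" "tgt \<J> u = src \<J> v"
  show "far (set_fctr_of \<J> S a) (cmp \<J> v u) =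
      cmp set_cat (far (set_fctr_of \<J> S a) v) (far (set_fctr_of \<J> S a) u)"
    using uv mem[OF uv(1)] cmp[OF uv]
    by (auto simp: set_fctr_of_def cmp_Ar compose_def intro!: restrict_ext)
qed

lemma is_ntrans_set_ntrans_of:
  fixes F G :: "('j, 'k, 'e set, 'e fn) fctr"
  assumes F: "is_functor \<J> set_cat F" and G: "is_functor \<J> set_cat G"
    and mem: "\<And>j x. \<lbrakk>j \<in> Ob \<J>; x \<in> fob F j\<rbrakk> \<Longrightarrow> t j x \<in> fob G j"
    and nat: "\<And>u x. \<lbrakk>u \<in> Ar \<J>; x \<in> fob F (src \<J> u)\<rbrakk> \<Longrightarrow>
      t (tgt \<J> u) (app (far F u) x) = app (far G u) (t (src \<J> u) x)"
  shows "is_ntrans \<J> set_cat (set_ntrans_of \<J> F G t)"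
  unfolding is_ntrans_def
proof (intro conjI ballI)
  have at_hom: "at (set_ntrans_of \<J> F G t) j \<in> hom set_cat (fob F j) (fob G j)"
    if "j \<in> Ob \<J>" for j
    using that by (simp add: set_ntrans_of_def in_hom_set_cat mem)
  show "at (set_ntrans_of \<J> F G t) \<in> extensional (Ob \<J>)"
    by (simp add: set_ntrans_of_def)
  show "at (set_ntrans_of \<J> F G t) j \<in>
      hom set_cat (fob (nsrc (set_ntrans_of \<J> F G t)) j) (fob (ntgt (set_ntrans_of \<J> F G t)) j)"
    if "j \<in> Ob \<J>" for j
    using at_hom[OF that] by simp
  fix u assume u: "u \<in> Ar \<J>"
  note hom = set_functor_far_hom[OF F u] set_functor_far_hom[OF G u]
    at_hom[OF src_Ob[OF u]] at_hom[OF tgt_Ob[OF u]]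
  show "cmp set_cat (at (set_ntrans_of \<J> F G t) (tgt \<J> u)) (far (nsrc (set_ntrans_of \<J> F G t)) u) =
      cmp set_cat (far (ntgt (set_ntrans_of \<J> F G t)) u) (at (set_ntrans_of \<J> F G t) (src \<J> u))"
  \<comment> \<open>Both composites lie in one hom set of \<open>set_cat\<close>, so the naturality
    square may be checked on elements.\<close>
  proof (rule fn_eqI[where X = "fob F (src \<J> u)" and Y = "fob G (tgt \<J> u)"])
    fix x assume "x \<in> fob F (src \<J> u)"
    then show "app (cmp set_cat (at (set_ntrans_of \<J> F G t) (tgt \<J> u))
          (far (nsrc (set_ntrans_of \<J> F G t)) u)) x =
        app (cmp set_cat (far (ntgt (set_ntrans_of \<J> F G t)) u)
          (at (set_ntrans_of \<J> F G t) (src \<J> u))) x"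
      using hom nat[OF u] set_functor_far_mem[OF F u]
      by (simp add: in_hom_set_cat compose_def src_Ob[OF u] tgt_Ob[OF u])
  qed (use hom in \<open>auto intro: cmp_hom_set_cat simp del: set_cat_simps\<close>)
qed (simp_all add: F G)

lemma set_ntrans_natural:
  assumes \<eta>: "is_ntrans \<J> set_cat \<eta>" and u: "u \<in> Ar \<J>" and x: "x \<in> fob (nsrc \<eta>) (src \<J> u)"
  shows "app (at \<eta> (tgt \<J> u)) (app (far (nsrc \<eta>) u) x) =
    app (far (ntgt \<eta>) u) (app (at \<eta> (src \<J> u)) x)"
proof -
  have F: "is_functor \<J> set_cat (nsrc \<eta>)"
    and eq: "cmp set_cat (at \<eta> (tgt \<J> u)) (far (nsrc \<eta>) u) =
      cmp set_cat (far (ntgt \<eta>) u) (at \<eta> (src \<J> u))"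
    using \<eta> u by (simp_all add: is_ntrans_def del: set_cat_simps)
  show ?thesis
    using arg_cong[OF eq, of "\<lambda>f. app f x"] set_functor_far_hom[OF F u]
      set_ntrans_at_hom[OF \<eta> src_Ob[OF u]] x
    by (simp add: in_hom_set_cat compose_def)
qed

lemma hom_functor_cat_natural:
  assumes "\<eta> \<in> hom (functor_cat \<J> set_cat) F G" "u \<in> Ar \<J>" "x \<in> fob F (src \<J> u)"
  shows "app (at \<eta> (tgt \<J> u)) (app (far F u) x) = app (far G u) (app (at \<eta> (src \<J> u)) x)"
  using assms set_ntrans_natural[of \<eta> u x] by (simp add: in_hom_functor_cat)

lemma is_functor_nsrc_ntgt:
  assumes "\<eta> \<in> hom (functor_cat \<J> set_cat) F G"
  shows "is_functor \<J> set_cat F" "is_functor \<J> set_cat G"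
  using assms unfolding in_hom_functor_cat is_ntrans_def by blast+

text \<open>The composite is recognised as a \<open>set_ntrans_of\<close>, which reduces its
  naturality to chasing one element through the squares of \<eta> and \<theta>.\<close>

lemma cmp_hom_functor_cat:
  assumes \<eta>: "\<eta> \<in> hom (functor_cat \<J> set_cat) F G" and \<theta>: "\<theta> \<in> hom (functor_cat \<J> set_cat) G K"
  shows "cmp (functor_cat \<J> set_cat) \<theta> \<eta> \<in> hom (functor_cat \<J> set_cat) F K"
proof -
  note * = \<eta>[unfolded in_hom_functor_cat] \<theta>[unfolded in_hom_functor_cat]
  have at: "at \<eta> j \<in> hom set_cat (fob F j) (fob G j)" "at \<theta> j \<in> hom set_cat (fob G j) (fob K j)"
    if "j \<in> Ob \<J>" for j
    using * that set_ntrans_at_hom[of \<J> \<eta> j] set_ntrans_at_hom[of \<J> \<theta> j] by simp_all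
  have "cmp (functor_cat \<J> set_cat) \<theta> \<eta> =
      set_ntrans_of \<J> F K (\<lambda>j x. app (at \<theta> j) (app (at \<eta> j) x))"
    using *(1,2) at[unfolded in_hom_set_cat]
    by (simp add: functor_cat_def set_ntrans_of_def compose_def cong: restrict_cong)
  moreover have "is_ntrans \<J> set_cat (set_ntrans_of \<J> F K (\<lambda>j x. app (at \<theta> j) (app (at \<eta> j) x)))"
    using is_functor_nsrc_ntgt[OF \<eta>] is_functor_nsrc_ntgt[OF \<theta>] hom_functor_cat_at_mem[OF \<eta>]
      hom_functor_cat_at_mem[OF \<theta>] hom_functor_cat_natural[OF \<eta>] hom_functor_cat_natural[OF \<theta>]
    by (intro is_ntrans_set_ntrans_of) (simp_all add: src_Ob)
  ultimately show ?thesis unfolding in_hom_functor_cat by simp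
qed

lemma idt_hom_functor_cat:
  fixes F :: "('j, 'k, 'e set, 'e fn) fctr"
  assumes "is_functor \<J> set_cat F"
  shows "idt (functor_cat \<J> set_cat) F \<in> hom (functor_cat \<J> set_cat) F F"
proof -
  have "idt (functor_cat \<J> set_cat) F = set_ntrans_of \<J> F F (\<lambda>j x. x)"
    by (simp add: functor_cat_def set_ntrans_of_def)
  then show ?thesis
    using assms is_ntrans_set_ntrans_of[OF assms assms, of "\<lambda>j x. x"]
    by (simp add: in_hom_functor_cat)
qed

section \<open>Pullbacks of set-valued functors\<close>

text \<open>Transporting both components of a pair keeps it in the pullback because \<alpha> and
  \<beta> are natural with the same target: both images come from transporting the one common
  boundary.\<close>

lemma is_functor_pb_fctr:
  assumes \<alpha>: "is_ntrans \<J> set_cat \<alpha>" and \<beta>: "is_ntrans \<J> set_cat \<beta>" and tgt: "ntgt \<alpha> = ntgt \<beta>"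
  shows "is_functor \<J> set_cat (pb_fctr \<J> \<alpha> \<beta>)"
proof -
  have F: "is_functor \<J> set_cat (nsrc \<alpha>)" "is_functor \<J> set_cat (nsrc \<beta>)"
    using \<alpha> \<beta> unfolding is_ntrans_def by blast+
  show ?thesis
    unfolding pb_fctr_eq using tgt F
    by (intro is_functor_set_fctr_of)
      (auto simp: pb_set_def set_functor_far_mem set_functor_far_idt set_functor_far_cmp
        set_ntrans_natural[OF \<alpha>] set_ntrans_natural[OF \<beta>])
qed

lemma pb_proj_hom:
  assumes \<alpha>: "is_ntrans \<J> set_cat \<alpha>" and \<beta>: "is_ntrans \<J> set_cat \<beta>" and tgt: "ntgt \<alpha> = ntgt \<beta>"
  shows "pb_proj1 \<J> \<alpha> \<beta> \<in> hom (functor_cat \<J> set_cat) (pb_fctr \<J> \<alpha> \<beta>) (nsrc \<alpha>)"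
    "pb_proj2 \<J> \<alpha> \<beta> \<in> hom (functor_cat \<J> set_cat) (pb_fctr \<J> \<alpha> \<beta>) (nsrc \<beta>)"
proof -
  have F: "is_functor \<J> set_cat (nsrc \<alpha>)" "is_functor \<J> set_cat (nsrc \<beta>)"
    using \<alpha> \<beta> unfolding is_ntrans_def by blast+
  note P = is_functor_pb_fctr[OF assms]
  show "pb_proj1 \<J> \<alpha> \<beta> \<in> hom (functor_cat \<J> set_cat) (pb_fctr \<J> \<alpha> \<beta>) (nsrc \<alpha>)"
    by (auto simp: pb_proj1_eq in_hom_functor_cat pb_set_def src_Ob
        intro!: is_ntrans_set_ntrans_of P F)
  show "pb_proj2 \<J> \<alpha> \<beta> \<in> hom (functor_cat \<J> set_cat) (pb_fctr \<J> \<alpha> \<beta>) (nsrc \<beta>)"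
    by (auto simp: pb_proj2_eq in_hom_functor_cat pb_set_def src_Ob
        intro!: is_ntrans_set_ntrans_of P F)
qed

lemma is_pullback_pb_fctr:
  fixes \<alpha> \<beta> :: "('j, 'k, 'm, 'h) set_ntrans"
  assumes \<alpha>: "is_ntrans \<J> set_cat \<alpha>" and \<beta>: "is_ntrans \<J> set_cat \<beta>" and tgt: "ntgt \<alpha> = ntgt \<beta>"
  shows "is_pullback (functor_cat \<J> set_cat) \<alpha> \<beta>
    (pb_fctr \<J> \<alpha> \<beta>) (pb_proj1 \<J> \<alpha> \<beta>) (pb_proj2 \<J> \<alpha> \<beta>)"
proof -
  let ?E = "functor_cat \<J> set_cat :: (('j, 'k, 'm, 'h) set_fctr, ('j, 'k, 'm, 'h) set_ntrans) cat"
  let ?P = "pb_fctr \<J> \<alpha> \<beta>"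
  note P = is_functor_pb_fctr[OF assms]
  note p = pb_proj_hom[OF assms]
  have hom: "\<alpha> \<in> hom ?E (nsrc \<alpha>) (ntgt \<alpha>)" "\<beta> \<in> hom ?E (nsrc \<beta>) (ntgt \<alpha>)"
    using assms by (simp_all add: in_hom_functor_cat)
  have square: "cmp ?E \<alpha> (pb_proj1 \<J> \<alpha> \<beta>) = cmp ?E \<beta> (pb_proj2 \<J> \<alpha> \<beta>)"
  proof (rule set_ntrans_eqI)
    show "cmp ?E \<alpha> (pb_proj1 \<J> \<alpha> \<beta>) \<in> hom ?E ?P (ntgt \<alpha>)"
      "cmp ?E \<beta> (pb_proj2 \<J> \<alpha> \<beta>) \<in> hom ?E ?P (ntgt \<alpha>)"
      using p hom by (auto intro: cmp_hom_functor_cat)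
  next
    fix j x assume "j \<in> Ob \<J>" "x \<in> fob ?P j"
    then show "app (at (cmp ?E \<alpha> (pb_proj1 \<J> \<alpha> \<beta>)) j) x = app (at (cmp ?E \<beta> (pb_proj2 \<J> \<alpha> \<beta>)) j) x"
      by (auto simp: app_cmp_functor_cat[OF p(1)] app_cmp_functor_cat[OF p(2)] pb_set_def)
  qed
  have universal: "\<exists>!h. h \<in> hom ?E T ?P \<and> cmp ?E (pb_proj1 \<J> \<alpha> \<beta>) h = u \<and> cmp ?E (pb_proj2 \<J> \<alpha> \<beta>) h = v"
    if T: "is_functor \<J> set_cat T" and u: "u \<in> hom ?E T (nsrc \<alpha>)" and v: "v \<in> hom ?E T (nsrc \<beta>)"
      and uv: "cmp ?E \<alpha> u = cmp ?E \<beta> v" for T u v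
  proof -
    \<comment> \<open>The equation \<open>uv\<close>, evaluated at j and t, is exactly the
      membership condition of \<open>pb_set\<close>.\<close>
    have pb: "Pr (app (at u j) t) (app (at v j) t) \<in> pb_set \<alpha> \<beta> j"
      if "j \<in> Ob \<J>" "t \<in> fob T j" for j t
      using arg_cong[OF uv, of "\<lambda>\<eta>. app (at \<eta> j) t"] that
        hom_functor_cat_at_mem[OF u that] hom_functor_cat_at_mem[OF v that]
      by (simp add: pb_set_def app_cmp_functor_cat[OF u] app_cmp_functor_cat[OF v])
    define h where "h = set_ntrans_of \<J> T ?P (\<lambda>j t. Pr (app (at u j) t) (app (at v j) t))"
    have h: "h \<in> hom ?E T ?P"
      unfolding h_def in_hom_functor_cat using T P pb
        hom_functor_cat_natural[OF u] hom_functor_cat_natural[OF v]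
      by (simp add: is_ntrans_set_ntrans_of src_Ob)
    show ?thesis
    proof (rule ex1I)
      have "cmp ?E (pb_proj1 \<J> \<alpha> \<beta>) h = u"
        using cmp_hom_functor_cat[OF h p(1)] u
        by (rule set_ntrans_eqI) (simp add: app_cmp_functor_cat[OF h], simp add: h_def pb)
      moreover have "cmp ?E (pb_proj2 \<J> \<alpha> \<beta>) h = v"
        using cmp_hom_functor_cat[OF h p(2)] v
        by (rule set_ntrans_eqI) (simp add: app_cmp_functor_cat[OF h], simp add: h_def pb)
      ultimately show "h \<in> hom ?E T ?P \<and> cmp ?E (pb_proj1 \<J> \<alpha> \<beta>) h = u \<and>
          cmp ?E (pb_proj2 \<J> \<alpha> \<beta>) h = v"
        using h by blast
    next
      fix k assume k: "k \<in> hom ?E T ?P \<and> cmp ?E (pb_proj1 \<J> \<alpha> \<beta>) k = u \<and>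
          cmp ?E (pb_proj2 \<J> \<alpha> \<beta>) k = v"
      then have k': "k \<in> hom ?E T ?P" by blast
      show "k = h"
        using k' h
      proof (rule set_ntrans_eqI)
        fix j t assume j: "j \<in> Ob \<J>" and t: "t \<in> fob T j"
        have kt: "app (at k j) t \<in> pb_set \<alpha> \<beta> j"
          using k' set_ntrans_at_mem[of \<J> k j t] j t by (simp add: in_hom_functor_cat)
        \<comment> \<open>Uniqueness: the projection equations fix both components of a value of k,
          and every element of \<open>pb_set\<close> is a pair, hence determined by them.\<close>
        have "pr1 (app (at k j) t) = app (at u j) t" "pr2 (app (at k j) t) = app (at v j) t"
          using k app_cmp_functor_cat[OF k' j t] kt j by auto
        with kt show "app (at k j) t = app (at h j) t"
          by (auto simp: h_def j t pb_set_def)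
      qed
    qed
  qed
  show ?thesis
    unfolding is_pullback_def
  proof (intro conjI ballI impI)
    fix T u v
    assume "T \<in> Ob ?E" "u \<in> hom ?E T (src ?E \<alpha>)" "v \<in> hom ?E T (src ?E \<beta>)"
      "cmp ?E \<alpha> u = cmp ?E \<beta> v"
    then show "\<exists>!h. h \<in> hom ?E T ?P \<and> cmp ?E (pb_proj1 \<J> \<alpha> \<beta>) h = u \<and>
        cmp ?E (pb_proj2 \<J> \<alpha> \<beta>) h = v"
      unfolding functor_cat_simps by (rule universal)
  qed (use \<alpha> \<beta> tgt P p square in simp_all)
qed

text \<open>The universal property gives only the two projections of the pairing. Its value follows
  because elements of the canonical pullback are literally pairs.\<close>

lemma pairing_pb_fctr:
  fixes \<alpha> \<beta> :: "('j, 'k, 'm, 'h) set_ntrans"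
  defines "\<E> \<equiv> functor_cat \<J> set_cat"
  assumes \<alpha>: "\<alpha> \<in> hom \<E> F K" and \<beta>: "\<beta> \<in> hom \<E> G K"
    and u: "u \<in> hom \<E> T F" and v: "v \<in> hom \<E> T G"
    and eq: "\<forall>j \<in> Ob \<J>. \<forall>t \<in> fob T j.
      app (at \<alpha> j) (app (at u j) t) = app (at \<beta> j) (app (at v j) t)"
  shows "pairing \<E> (pb_proj1 \<J> \<alpha> \<beta>) (pb_proj2 \<J> \<alpha> \<beta>) u v \<in> hom \<E> T (pb_fctr \<J> \<alpha> \<beta>)"
    and "\<lbrakk>j \<in> Ob \<J>; t \<in> fob T j\<rbrakk> \<Longrightarrow>
      app (at (pairing \<E> (pb_proj1 \<J> \<alpha> \<beta>) (pb_proj2 \<J> \<alpha> \<beta>) u v) j) t =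
        Pr (app (at u j) t) (app (at v j) t)"
proof -
  have nt: "is_ntrans \<J> set_cat \<alpha>" "is_ntrans \<J> set_cat \<beta>" "ntgt \<alpha> = ntgt \<beta>"
    and src: "nsrc \<alpha> = F" "nsrc \<beta> = G"
    using \<alpha> \<beta> by (simp_all add: \<E>_def in_hom_functor_cat)
  \<comment> \<open>The pointwise hypothesis \<open>eq\<close> is lifted to an equation of
    transformations, the form in which the universal property asks for it.\<close>
  have "cmp \<E> \<alpha> u = cmp \<E> \<beta> v"
    using cmp_hom_functor_cat[OF u[unfolded \<E>_def] \<alpha>[unfolded \<E>_def]]
      cmp_hom_functor_cat[OF v[unfolded \<E>_def] \<beta>[unfolded \<E>_def]] u v eq
    unfolding \<E>_def by (auto simp: app_cmp_functor_cat intro: set_ntrans_eqI)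
  moreover have "T \<in> Ob \<E>"
    using is_functor_nsrc_ntgt(1) u by (simp add: \<E>_def)
  ultimately have h: "pairing \<E> (pb_proj1 \<J> \<alpha> \<beta>) (pb_proj2 \<J> \<alpha> \<beta>) u v \<in> hom \<E> T (pb_fctr \<J> \<alpha> \<beta>)"
    and h1: "cmp \<E> (pb_proj1 \<J> \<alpha> \<beta>) (pairing \<E> (pb_proj1 \<J> \<alpha> \<beta>) (pb_proj2 \<J> \<alpha> \<beta>) u v) = u"
    and h2: "cmp \<E> (pb_proj2 \<J> \<alpha> \<beta>) (pairing \<E> (pb_proj1 \<J> \<alpha> \<beta>) (pb_proj2 \<J> \<alpha> \<beta>) u v) = v"
    (is "cmp _ _ ?h = _")
    using pairing_pullback[OF is_pullback_pb_fctr[OF nt], folded \<E>_def, of T u v] u v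
    by (simp_all add: \<E>_def src)
  show "?h \<in> hom \<E> T (pb_fctr \<J> \<alpha> \<beta>)" by (rule h)
  assume j: "j \<in> Ob \<J>" and t: "t \<in> fob T j"
  have ht: "app (at ?h j) t \<in> pb_set \<alpha> \<beta> j"
    using hom_functor_cat_at_mem[OF h[unfolded \<E>_def] j t] j by (simp add: \<E>_def)
  have "app (at u j) t = pr1 (app (at ?h j) t)" "app (at v j) t = pr2 (app (at ?h j) t)"
    using app_cmp_functor_cat[OF h[unfolded \<E>_def] j t, folded \<E>_def] h1 h2 ht j
    by (metis app_pb_proj(1), metis app_pb_proj(2))
  with ht show "app (at ?h j) t = Pr (app (at u j) t) (app (at v j) t)"
    by (auto simp: pb_set_def)
qed

text \<open>
  A pullback is only given by its universal property; its elements are obtained by mapping into it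
  from the canonical pullback of pairs.
\<close>

lemma is_pullback_surj:
  fixes \<alpha> \<beta> :: "('j, 'k, 'm, 'h) set_ntrans"
  assumes pb: "is_pullback (functor_cat \<J> set_cat) \<alpha> \<beta> Q q r" and j: "j \<in> Ob \<J>"
    and x: "Pr x x' \<in> pb_set \<alpha> \<beta> j"
  obtains z where "z \<in> fob Q j" "app (at q j) z = x" "app (at r j) z = x'"
proof -
  let ?E = "functor_cat \<J> set_cat :: (('j, 'k, 'm, 'h) set_fctr, ('j, 'k, 'm, 'h) set_ntrans) cat"
  have nt: "is_ntrans \<J> set_cat \<alpha>" "is_ntrans \<J> set_cat \<beta>" "ntgt \<alpha> = ntgt \<beta>"
    using pb by (simp_all add: is_pullback_def)
  note canonical = is_pullback_pb_fctr[OF nt]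
  have "\<exists>!h. h \<in> hom ?E (pb_fctr \<J> \<alpha> \<beta>) Q \<and> cmp ?E q h = pb_proj1 \<J> \<alpha> \<beta> \<and>
      cmp ?E r h = pb_proj2 \<J> \<alpha> \<beta>"
    using pb canonical unfolding is_pullback_def by blast
  then obtain h where h: "h \<in> hom ?E (pb_fctr \<J> \<alpha> \<beta>) Q"
    and qh: "cmp ?E q h = pb_proj1 \<J> \<alpha> \<beta>" and rh: "cmp ?E r h = pb_proj2 \<J> \<alpha> \<beta>"
    by blast
  have x': "Pr x x' \<in> fob (pb_fctr \<J> \<alpha> \<beta>) j"
    using x j by simp
  show thesis
  proof
    show "app (at h j) (Pr x x') \<in> fob Q j"
      by (rule hom_functor_cat_at_mem[OF h j x'])
    show "app (at q j) (app (at h j) (Pr x x')) = x" "app (at r j) (app (at h j) (Pr x x')) = x'"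
      using app_cmp_functor_cat[OF h j x', of q] app_cmp_functor_cat[OF h j x', of r] qh rh
        app_pb_proj[OF j x] by simp_all
  qed
qed

end

section \<open>Internal categories in a functor category, fibre by fibre\<close>

text \<open>The laws of an ordinary category with objects \<open>fob X\<^sub>0 j\<close> and arrows
  \<open>fob X\<^sub>1 j\<close>. No object of triples occurs: a triple is composable as soon as its
  two consecutive pairs are.\<close>

definition fibre_category ::
    "('j, 'k, 'm, 'h) set_fctr \<Rightarrow> ('j, 'k, 'm, 'h) set_fctr \<Rightarrow>
     ('j, 'k, 'm, 'h) set_ntrans \<Rightarrow> ('j, 'k, 'm, 'h) set_ntrans \<Rightarrow>
     ('j, 'k, 'm, 'h) set_ntrans \<Rightarrow> ('j, 'k, 'm, 'h) set_ntrans \<Rightarrow> 'j \<Rightarrow> bool" where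
  "fibre_category X\<^sub>0 X\<^sub>1 d c e m j \<longleftrightarrow>
     (\<forall>f \<in> fob X\<^sub>0 j. app (at d j) (app (at e j) f) = f \<and> app (at c j) (app (at e j) f) = f) \<and>
     (\<forall>x \<in> fob X\<^sub>1 j. app (at m j) (Pr (app (at e j) (app (at c j) x)) x) = x \<and>
        app (at m j) (Pr x (app (at e j) (app (at d j) x))) = x) \<and>
     (\<forall>x x'. Pr x x' \<in> pb_set d c j \<longrightarrow>
        app (at d j) (app (at m j) (Pr x x')) = app (at d j) x' \<and>
        app (at c j) (app (at m j) (Pr x x')) = app (at c j) x) \<and>
     (\<forall>x x' x''. Pr x x' \<in> pb_set d c j \<longrightarrow> Pr x' x'' \<in> pb_set d c j \<longrightarrow>
        app (at m j) (Pr x (app (at m j) (Pr x' x''))) =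
        app (at m j) (Pr (app (at m j) (Pr x x')) x''))"

text \<open>Only the types of the four structure maps, that is their naturality, are assumed. The
  equations are left out so that the equivalence with the fibrewise laws can be used in both
  directions.\<close>

locale internal_category_data = diagram_shape \<J> for \<J> :: "('j, 'k) cat" +
  fixes X\<^sub>0 X\<^sub>1 :: "('j, 'k, 'm, 'h) set_fctr" and d c e m :: "('j, 'k, 'm, 'h) set_ntrans"
  assumes d_hom: "d \<in> hom (functor_cat \<J> set_cat) X\<^sub>1 X\<^sub>0"
    and c_hom: "c \<in> hom (functor_cat \<J> set_cat) X\<^sub>1 X\<^sub>0"
    and e_hom: "e \<in> hom (functor_cat \<J> set_cat) X\<^sub>0 X\<^sub>1"
    and m_hom: "m \<in> hom (functor_cat \<J> set_cat) (pb_fctr \<J> d c) X\<^sub>1"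
begin

abbreviation \<E> :: "(('j, 'k, 'm, 'h) set_fctr, ('j, 'k, 'm, 'h) set_ntrans) cat"
  where "\<E> \<equiv> functor_cat \<J> set_cat"
abbreviation "P \<equiv> pb_fctr \<J> d c"
abbreviation "p \<equiv> pb_proj1 \<J> d c"
abbreviation "p' \<equiv> pb_proj2 \<J> d c"

lemma is_functor_X: "is_functor \<J> set_cat X\<^sub>0" "is_functor \<J> set_cat X\<^sub>1"
  using is_functor_nsrc_ntgt[OF d_hom] by simp_all

lemma P_pullback: "is_pullback \<E> d c P p p'"
  using d_hom c_hom by (intro is_pullback_pb_fctr) (simp_all add: in_hom_functor_cat)

lemma p_hom: "p \<in> hom \<E> P X\<^sub>1" and p'_hom: "p' \<in> hom \<E> P X\<^sub>1"
  using pb_proj_hom[of d c] d_hom c_hom by (simp_all add: in_hom_functor_cat)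

lemma in_pb_set:
  "z \<in> pb_set d c j \<longleftrightarrow> (\<exists>x \<in> fob X\<^sub>1 j. \<exists>x' \<in> fob X\<^sub>1 j. z = Pr x x' \<and>
    app (at d j) x = app (at c j) x')"
  using d_hom c_hom by (auto simp: pb_set_def in_hom_functor_cat)

lemma pb_set_ball: "(\<forall>z \<in> pb_set d c j. Q z) \<longleftrightarrow> (\<forall>x x'. Pr x x' \<in> pb_set d c j \<longrightarrow> Q (Pr x x'))"
  by (auto simp: in_pb_set)

lemmas homs = d_hom c_hom e_hom m_hom p_hom p'_hom
  idt_hom_functor_cat[OF is_functor_X(1)] idt_hom_functor_cat[OF is_functor_X(2)]
lemmas app_cmp = homs[THEN app_cmp_functor_cat]
lemmas at_mem = homs[THEN hom_functor_cat_at_mem]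
lemmas cmp_homs = cmp_hom_functor_cat

lemma m_mem: "\<lbrakk>j \<in> Ob \<J>; z \<in> pb_set d c j\<rbrakk> \<Longrightarrow> app (at m j) z \<in> fob X\<^sub>1 j"
  using at_mem(4)[of j z] by simp

lemma section_iff:
  assumes "s \<in> hom \<E> X\<^sub>1 X\<^sub>0"
  shows "cmp \<E> s e = idt \<E> X\<^sub>0 \<longleftrightarrow> (\<forall>j \<in> Ob \<J>. \<forall>f \<in> fob X\<^sub>0 j. app (at s j) (app (at e j) f) = f)"
  by (subst hom_functor_cat_eq_iff[OF cmp_homs[OF e_hom assms] homs(7)]) (simp add: app_cmp)

text \<open>The map s is left general to stand for either boundary: the first version is used for c,
  the second for d.\<close>

lemma boundary_plus_iff:
  assumes "s \<in> hom \<E> X\<^sub>1 X\<^sub>0"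
  shows "cmp \<E> s m = cmp \<E> s p \<longleftrightarrow>
      (\<forall>j \<in> Ob \<J>. \<forall>z \<in> pb_set d c j. app (at s j) (app (at m j) z) = app (at s j) (pr1 z))"
    and "cmp \<E> s m = cmp \<E> s p' \<longleftrightarrow>
      (\<forall>j \<in> Ob \<J>. \<forall>z \<in> pb_set d c j. app (at s j) (app (at m j) z) = app (at s j) (pr2 z))"
  by (simp_all add: hom_functor_cat_eq_iff[OF cmp_homs[OF m_hom assms] cmp_homs[OF p_hom assms]]
      hom_functor_cat_eq_iff[OF cmp_homs[OF m_hom assms] cmp_homs[OF p'_hom assms]] app_cmp)

text \<open>The hypothesis \<open>eq\<close> says that u and v are pointwise composable, which is
  what makes the pairing denote. Each unit and associativity law has to supply it before its value
  can be computed.\<close>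

lemma pairing_then_m:
  assumes u: "u \<in> hom \<E> T X\<^sub>1" and v: "v \<in> hom \<E> T X\<^sub>1"
    and eq: "\<forall>j \<in> Ob \<J>. \<forall>t \<in> fob T j.
      app (at d j) (app (at u j) t) = app (at c j) (app (at v j) t)"
  shows "cmp \<E> m (pairing \<E> p p' u v) \<in> hom \<E> T X\<^sub>1"
    and "\<lbrakk>j \<in> Ob \<J>; t \<in> fob T j\<rbrakk> \<Longrightarrow> app (at (cmp \<E> m (pairing \<E> p p' u v)) j) t =
      app (at m j) (Pr (app (at u j) t) (app (at v j) t))"
proof -
  note h = pairing_pb_fctr(1)[OF d_hom c_hom u v eq]
  show "cmp \<E> m (pairing \<E> p p' u v) \<in> hom \<E> T X\<^sub>1"
    by (rule cmp_homs[OF h m_hom])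
  assume "j \<in> Ob \<J>" "t \<in> fob T j"
  then show "app (at (cmp \<E> m (pairing \<E> p p' u v)) j) t =
      app (at m j) (Pr (app (at u j) t) (app (at v j) t))"
    using app_cmp_functor_cat[OF h, of j t m] pairing_pb_fctr(2)[OF d_hom c_hom u v eq, of j t]
    by simp
qed

text \<open>The pair (e c x, x) is composable because d e = 1 gives d (e (c x)) = c x.\<close>

lemma left_unit_iff:
  assumes "cmp \<E> d e = idt \<E> X\<^sub>0"
  shows "cmp \<E> m (pairing \<E> p p' (cmp \<E> e c) (idt \<E> X\<^sub>1)) = idt \<E> X\<^sub>1 \<longleftrightarrow>
    (\<forall>j \<in> Ob \<J>. \<forall>x \<in> fob X\<^sub>1 j. app (at m j) (Pr (app (at e j) (app (at c j) x)) x) = x)"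
proof -
  have "\<forall>j \<in> Ob \<J>. \<forall>x \<in> fob X\<^sub>1 j.
      app (at d j) (app (at (cmp \<E> e c) j) x) = app (at c j) (app (at (idt \<E> X\<^sub>1) j) x)"
    using assms at_mem(2) by (simp add: app_cmp section_iff[OF d_hom])
  note * = pairing_then_m[OF cmp_homs[OF c_hom e_hom] homs(8) this]
  show ?thesis
    by (subst hom_functor_cat_eq_iff[OF *(1) homs(8)]) (simp add: *(2) app_cmp)
qed

lemma right_unit_iff:
  assumes "cmp \<E> c e = idt \<E> X\<^sub>0"
  shows "cmp \<E> m (pairing \<E> p p' (idt \<E> X\<^sub>1) (cmp \<E> e d)) = idt \<E> X\<^sub>1 \<longleftrightarrow>
    (\<forall>j \<in> Ob \<J>. \<forall>x \<in> fob X\<^sub>1 j. app (at m j) (Pr x (app (at e j) (app (at d j) x))) = x)"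
proof -
  have "\<forall>j \<in> Ob \<J>. \<forall>x \<in> fob X\<^sub>1 j.
      app (at d j) (app (at (idt \<E> X\<^sub>1) j) x) = app (at c j) (app (at (cmp \<E> e d) j) x)"
    using assms at_mem(1) by (simp add: app_cmp section_iff[OF c_hom])
  note * = pairing_then_m[OF homs(8) cmp_homs[OF d_hom e_hom] this]
  show ?thesis
    by (subst hom_functor_cat_eq_iff[OF *(1) homs(8)]) (simp add: *(2) app_cmp)
qed

text \<open>The boundary laws \<open>dm\<close> and \<open>cm\<close> make the nested pairs of both
  sides composable. The arrow equation then quantifies over elements of Q, and these cover exactly
  the composable triples, whichever pullback Q is: the square of Q gives one inclusion,
  \<open>is_pullback_surj\<close> the other.\<close>

lemma assoc_iff:
  assumes dm: "cmp \<E> d m = cmp \<E> d p'" and cm: "cmp \<E> c m = cmp \<E> c p"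
    and pb: "is_pullback \<E> (cmp \<E> d p') c Q q r"
  shows "cmp \<E> m (pairing \<E> p p' (cmp \<E> p q) (cmp \<E> m (pairing \<E> p p' (cmp \<E> p' q) r))) =
      cmp \<E> m (pairing \<E> p p' (cmp \<E> m q) r) \<longleftrightarrow>
    (\<forall>j \<in> Ob \<J>. \<forall>x x' x''. Pr x x' \<in> pb_set d c j \<longrightarrow> Pr x' x'' \<in> pb_set d c j \<longrightarrow>
      app (at m j) (Pr x (app (at m j) (Pr x' x''))) =
      app (at m j) (Pr (app (at m j) (Pr x x')) x''))" (is "?L = ?R \<longleftrightarrow> _")
proof -
  have q: "q \<in> hom \<E> Q P" and r: "r \<in> hom \<E> Q X\<^sub>1" and square: "cmp \<E> (cmp \<E> d p') q = cmp \<E> c r"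
    using pb p'_hom c_hom unfolding is_pullback_def by (simp_all add: in_hom_functor_cat)
  have square': "app (at d j) (pr2 (app (at q j) z)) = app (at c j) (app (at r j) z)"
    and qz: "app (at q j) z \<in> pb_set d c j" if "j \<in> Ob \<J>" "z \<in> fob Q j" for j z
  proof -
    show qz: "app (at q j) z \<in> pb_set d c j"
      using hom_functor_cat_at_mem[OF q that] that by simp
    show "app (at d j) (pr2 (app (at q j) z)) = app (at c j) (app (at r j) z)"
      using arg_cong[OF square, of "\<lambda>\<eta>. app (at \<eta> j) z"] that qz
      by (simp add: app_cmp app_cmp_functor_cat[OF q] app_cmp_functor_cat[OF r])
  qed
  have inner: "\<forall>j \<in> Ob \<J>. \<forall>z \<in> fob Q j.
      app (at d j) (app (at (cmp \<E> p' q) j) z) = app (at c j) (app (at r j) z)"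
    using square' qz by (simp add: app_cmp_functor_cat[OF q])
  note i = pairing_then_m[OF cmp_homs[OF q p'_hom] r inner]
  have left: "\<forall>j \<in> Ob \<J>. \<forall>z \<in> fob Q j. app (at d j) (app (at (cmp \<E> p q) j) z) =
      app (at c j) (app (at (cmp \<E> m (pairing \<E> p p' (cmp \<E> p' q) r)) j) z)"
  proof (intro ballI)
    fix j z assume that: "j \<in> Ob \<J>" "z \<in> fob Q j"
    \<comment> \<open>With q z = (x, x') and r z = x'', the pair (x', x'') is composable, so
      \<open>cm\<close> yields c (x' + x'') = c x', which equals d x.\<close>
    have "Pr (pr2 (app (at q j) z)) (app (at r j) z) \<in> pb_set d c j"
      using square'[OF that] qz[OF that] hom_functor_cat_at_mem[OF r that]
      by (auto simp: in_pb_set)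
    then show "app (at d j) (app (at (cmp \<E> p q) j) z) =
        app (at c j) (app (at (cmp \<E> m (pairing \<E> p p' (cmp \<E> p' q) r)) j) z)"
      using cm that qz[OF that]
      by (auto simp: i(2) boundary_plus_iff[OF c_hom] app_cmp_functor_cat[OF q] in_pb_set)
  qed
  note l = pairing_then_m[OF cmp_homs[OF q p_hom] i(1) left]
  have right: "\<forall>j \<in> Ob \<J>. \<forall>z \<in> fob Q j.
      app (at d j) (app (at (cmp \<E> m q) j) z) = app (at c j) (app (at r j) z)"
    using dm square' qz by (simp add: boundary_plus_iff[OF d_hom] app_cmp_functor_cat[OF q])
  note rt = pairing_then_m[OF cmp_homs[OF q m_hom] r right]
  have "?L = ?R \<longleftrightarrow> (\<forall>j \<in> Ob \<J>. \<forall>z \<in> fob Q j.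
      app (at m j) (Pr (pr1 (app (at q j) z)) (app (at m j) (Pr (pr2 (app (at q j) z)) (app (at r j) z)))) =
      app (at m j) (Pr (app (at m j) (app (at q j) z)) (app (at r j) z)))"
    by (subst hom_functor_cat_eq_iff[OF l(1) rt(1)])
      (simp add: l(2) rt(2) i(2) app_cmp_functor_cat[OF q] qz cong: ball_cong)
  also have "\<dots> \<longleftrightarrow>
    (\<forall>j \<in> Ob \<J>. \<forall>x x' x''. Pr x x' \<in> pb_set d c j \<longrightarrow> Pr x' x'' \<in> pb_set d c j \<longrightarrow>
      app (at m j) (Pr x (app (at m j) (Pr x' x''))) =
      app (at m j) (Pr (app (at m j) (Pr x x')) x''))"
  proof (intro iffI ballI allI impI)
    fix j x x' x''
    assume eq: "\<forall>j \<in> Ob \<J>. \<forall>z \<in> fob Q j.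
      app (at m j) (Pr (pr1 (app (at q j) z)) (app (at m j) (Pr (pr2 (app (at q j) z)) (app (at r j) z)))) =
      app (at m j) (Pr (app (at m j) (app (at q j) z)) (app (at r j) z))"
      and j: "j \<in> Ob \<J>" and x: "Pr x x' \<in> pb_set d c j" and x': "Pr x' x'' \<in> pb_set d c j"
    \<comment> \<open>The first leg of the pullback Q is d p', which sends (x, x') to d x'; this is
      c x'' by the second composability hypothesis.\<close>
    have "Pr (Pr x x') x'' \<in> pb_set (cmp \<E> d p') c j"
      using x x' j c_hom p'_hom app_cmp(6)[OF j, of "Pr x x'" d]
      by (auto simp: pb_set_def in_hom_functor_cat)
    with pb j obtain z where "z \<in> fob Q j" "app (at q j) z = Pr x x'" "app (at r j) z = x''"
      by (rule is_pullback_surj)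
    with eq j show "app (at m j) (Pr x (app (at m j) (Pr x' x''))) =
        app (at m j) (Pr (app (at m j) (Pr x x')) x'')"
      by force
  next
    fix j z
    assume eq: "\<forall>j \<in> Ob \<J>. \<forall>x x' x''. Pr x x' \<in> pb_set d c j \<longrightarrow> Pr x' x'' \<in> pb_set d c j \<longrightarrow>
      app (at m j) (Pr x (app (at m j) (Pr x' x''))) =
      app (at m j) (Pr (app (at m j) (Pr x x')) x'')"
      and j: "j \<in> Ob \<J>" and z: "z \<in> fob Q j"
    \<comment> \<open>Conversely, an element z of Q yields the triple formed by the pair q z and the
      element r z.\<close>
    from qz[OF j z] obtain x x' where x: "app (at q j) z = Pr x x'" "Pr x x' \<in> pb_set d c j"
      by (auto simp: in_pb_set)
    then have "Pr x' (app (at r j) z) \<in> pb_set d c j"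
      using square'[OF j z] hom_functor_cat_at_mem[OF r j z] by (auto simp: in_pb_set)
    with eq j x show "app (at m j) (Pr (pr1 (app (at q j) z))
          (app (at m j) (Pr (pr2 (app (at q j) z)) (app (at r j) z)))) =
        app (at m j) (Pr (app (at m j) (app (at q j) z)) (app (at r j) z))"
      by simp
  qed
  finally show ?thesis .
qed

lemma internal_category_iff:
  "internal_category \<E> X\<^sub>0 X\<^sub>1 d c e m P p p' \<longleftrightarrow> (\<forall>j \<in> Ob \<J>. fibre_category X\<^sub>0 X\<^sub>1 d c e m j)"
proof -
  let ?lu = "cmp \<E> m (pairing \<E> p p' (cmp \<E> e c) (idt \<E> X\<^sub>1)) = idt \<E> X\<^sub>1"
  let ?ru = "cmp \<E> m (pairing \<E> p p' (idt \<E> X\<^sub>1) (cmp \<E> e d)) = idt \<E> X\<^sub>1"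
  let ?assoc = "\<lambda>q r. cmp \<E> m (pairing \<E> p p' (cmp \<E> p q) (cmp \<E> m (pairing \<E> p p' (cmp \<E> p' q) r))) =
      cmp \<E> m (pairing \<E> p p' (cmp \<E> m q) r)"
  let ?fibre_assoc = "\<forall>j \<in> Ob \<J>. \<forall>x x' x''. Pr x x' \<in> pb_set d c j \<longrightarrow> Pr x' x'' \<in> pb_set d c j \<longrightarrow>
      app (at m j) (Pr x (app (at m j) (Pr x' x''))) =
      app (at m j) (Pr (app (at m j) (Pr x x')) x'')"
  have ic: "internal_category \<E> X\<^sub>0 X\<^sub>1 d c e m P p p' \<longleftrightarrow>
      cmp \<E> d e = idt \<E> X\<^sub>0 \<and> cmp \<E> c e = idt \<E> X\<^sub>0 \<and>
      cmp \<E> d m = cmp \<E> d p' \<and> cmp \<E> c m = cmp \<E> c p \<and> ?lu \<and> ?ru \<and>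
      (\<exists>Q q r. is_pullback \<E> (cmp \<E> d p') c Q q r \<and> ?assoc q r)"
    unfolding internal_category_def Let_def
    by (simp only: functor_cat_simps is_functor_X homs P_pullback simp_thms)
  \<comment> \<open>The canonical pullback witnesses that some Q exists. Since
    \<open>assoc_iff\<close> gives the same fibrewise law for every Q, the existential quantifier
    disappears.\<close>
  have "is_pullback \<E> (cmp \<E> d p') c (pb_fctr \<J> (cmp \<E> d p') c)
      (pb_proj1 \<J> (cmp \<E> d p') c) (pb_proj2 \<J> (cmp \<E> d p') c)"
    using cmp_homs[OF p'_hom d_hom] c_hom
    by (intro is_pullback_pb_fctr) (simp_all add: in_hom_functor_cat)
  then have assoc: "(\<exists>Q q r. is_pullback \<E> (cmp \<E> d p') c Q q r \<and> ?assoc q r) \<longleftrightarrow> ?fibre_assoc"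
    if "cmp \<E> d m = cmp \<E> d p'" "cmp \<E> c m = cmp \<E> c p"
    using assoc_iff[OF that] by blast
  have "internal_category \<E> X\<^sub>0 X\<^sub>1 d c e m P p p' \<longleftrightarrow>
      (\<forall>j \<in> Ob \<J>. \<forall>f \<in> fob X\<^sub>0 j. app (at d j) (app (at e j) f) = f) \<and>
      (\<forall>j \<in> Ob \<J>. \<forall>f \<in> fob X\<^sub>0 j. app (at c j) (app (at e j) f) = f) \<and>
      (\<forall>j \<in> Ob \<J>. \<forall>z \<in> pb_set d c j. app (at d j) (app (at m j) z) = app (at d j) (pr2 z)) \<and>
      (\<forall>j \<in> Ob \<J>. \<forall>z \<in> pb_set d c j. app (at c j) (app (at m j) z) = app (at c j) (pr1 z)) \<and>
      (\<forall>j \<in> Ob \<J>. \<forall>x \<in> fob X\<^sub>1 j. app (at m j) (Pr (app (at e j) (app (at c j) x)) x) = x) \<and>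
      (\<forall>j \<in> Ob \<J>. \<forall>x \<in> fob X\<^sub>1 j. app (at m j) (Pr x (app (at e j) (app (at d j) x))) = x) \<and>
      ?fibre_assoc"
    \<comment> \<open>The congruence rule \<open>conj_cong\<close> provides earlier conjuncts as
      hypotheses for later ones: the section equations for the unit laws, the boundary equations for
      associativity.\<close>
    unfolding ic
    by (simp only: section_iff[OF d_hom, symmetric] section_iff[OF c_hom, symmetric]
        boundary_plus_iff(2)[OF d_hom, symmetric] boundary_plus_iff(1)[OF c_hom, symmetric]
        left_unit_iff[symmetric] right_unit_iff[symmetric] assoc cong: conj_cong)
  also have "\<dots> \<longleftrightarrow> (\<forall>j \<in> Ob \<J>. fibre_category X\<^sub>0 X\<^sub>1 d c e m j)"
    by (simp only: fibre_category_def pb_set_ball elt.sel) blast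
  finally show ?thesis .
qed

end

section \<open>Opposite and product categories; the hom functor\<close>

lemma hom_op_cat: "hom (op_cat \<C>) A B = hom \<C> B A"
  by (auto simp: hom_def op_cat_def)

lemma hom_prod_cat: "hom (prod_cat \<C> \<D>) X Y = hom \<C> (fst X) (fst Y) \<times> hom \<D> (snd X) (snd Y)"
  by (cases X; cases Y) (auto simp: hom_def prod_cat_def)

lemma category_op_cat:
  assumes "category \<C>"
  shows "category (op_cat \<C>)"
proof -
  interpret category \<C> by (rule assms)
  show ?thesis
    by unfold_locales
      (simp_all add: hom_op_cat,
        simp_all add: op_cat_def src_Ob tgt_Ob idt_hom cmp_hom cmp_idt_left cmp_idt_right cmp_assoc)
qed

lemma category_prod_cat:
  assumes "category \<C>" "category \<D>"
  shows "category (prod_cat \<C> \<D>)"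
proof -
  interpret C: category \<C> by (rule assms)
  interpret D: category \<D> by (rule assms)
  show ?thesis
    by unfold_locales
      (simp_all add: hom_prod_cat,
        auto simp: prod_cat_def C.src_Ob C.tgt_Ob C.idt_hom C.cmp_hom C.cmp_idt_left
        C.cmp_idt_right C.cmp_assoc D.src_Ob D.tgt_Ob D.idt_hom D.cmp_hom D.cmp_idt_left
        D.cmp_idt_right D.cmp_assoc)
qed

lemma op_prod_simps [simp]:
  "Ob (op_prod \<C>) = Ob \<C> \<times> Ob \<C>" "Ar (op_prod \<C>) = Ar \<C> \<times> Ar \<C>"
  "src (op_prod \<C>) (f, g) = (tgt \<C> f, src \<C> g)" "tgt (op_prod \<C>) (f, g) = (src \<C> f, tgt \<C> g)"
  "idt (op_prod \<C>) (A, B) = (idt \<C> A, idt \<C> B)"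
  "cmp (op_prod \<C>) (f', g') (f, g) = (cmp \<C> f f', cmp \<C> g' g)"
  by (simp_all add: prod_cat_def op_cat_def)

lemma homD:
  assumes "f \<in> hom \<C> A B"
  shows "f \<in> Ar \<C>" "src \<C> f = A" "tgt \<C> f = B"
  using assms by (simp_all add: hom_def)

lemma in_hom_src_tgt: "f \<in> Ar \<C> \<Longrightarrow> f \<in> hom \<C> (src \<C> f) (tgt \<C> f)"
  by (simp add: hom_def)

lemma (in category) hom_Ob: "f \<in> hom \<C> A B \<Longrightarrow> A \<in> Ob \<C>" "f \<in> hom \<C> A B \<Longrightarrow> B \<in> Ob \<C>"
  using src_Ob tgt_Ob by (auto simp: hom_def)

lemma hom_fctr_eq: "hom_fctr \<C> = set_fctr_of (op_prod \<C>) (\<lambda>(A, B). Mor ` hom \<C> A B)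
    (\<lambda>(f, g) h. Mor (cmp \<C> (cmp \<C> g (the_mor h)) f))"
  unfolding hom_fctr_def set_fctr_of_def by (auto intro!: restrict_ext)

lemma fob_hom_fctr [simp]:
  "\<lbrakk>A \<in> Ob \<C>; B \<in> Ob \<C>\<rbrakk> \<Longrightarrow> fob (hom_fctr \<C>) (A, B) = Mor ` hom \<C> A B"
  by (simp add: hom_fctr_eq)

context category
begin

lemma diagram_shape_op_prod: "diagram_shape (op_prod \<C>)"
  by (intro diagram_shape.intro category_prod_cat category_op_cat category_axioms)

lemma app_far_hom_fctr [simp]:
  assumes "f \<in> hom \<C> A' A" "g \<in> hom \<C> B B'" "h \<in> hom \<C> A B"
  shows "app (far (hom_fctr \<C>) (f, g)) (Mor h) = Mor ((g \<cdot> h) \<cdot> f)"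
  using assms by (simp add: hom_fctr_eq homD)

lemma is_functor_hom_fctr:
  "is_functor (op_prod \<C>) set_cat (hom_fctr \<C> :: ('o, 'm, 'h) bifctr)"
  unfolding hom_fctr_eq
proof (rule diagram_shape.is_functor_set_fctr_of[OF diagram_shape_op_prod], goal_cases)
  case (1 u x)
  then show ?case
    by (auto intro!: imageI cmp_hom dest: in_hom_src_tgt)
next
  case (2 j x)
  then show ?case by (auto simp: cmp_idt_left cmp_idt_right)
next
  case (3 u v x)
  obtain f g f' g' where uv: "u = (f, g)" "v = (f', g')" by (metis surj_pair)
  with 3 obtain h where x: "x = Mor h" and h: "h \<in> hom \<C> (tgt \<C> f) (src \<C> g)" by auto
  have f: "f \<in> hom \<C> (src \<C> f) (tgt \<C> f)" and g: "g \<in> hom \<C> (src \<C> g) (tgt \<C> g)"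
    and f': "f' \<in> hom \<C> (src \<C> f') (src \<C> f)" and g': "g' \<in> hom \<C> (tgt \<C> g) (tgt \<C> g')"
    using 3 uv by (auto simp: hom_def)
  note gh = cmp_hom[OF h g]
  \<comment> \<open>The first coordinate of \<open>op_prod \<C>\<close> composes in reverse, so the
    composite acts by precomposition with \<open>f \<cdot> f'\<close>.\<close>
  have "((g' \<cdot> g) \<cdot> h) \<cdot> (f \<cdot> f') = (g' \<cdot> (g \<cdot> h)) \<cdot> (f \<cdot> f')"
    using cmp_assoc[OF h g g'] by simp
  also have "\<dots> = ((g' \<cdot> (g \<cdot> h)) \<cdot> f) \<cdot> f'"
    by (rule cmp_assoc[OF f' f cmp_hom[OF gh g']])
  also have "\<dots> = (g' \<cdot> ((g \<cdot> h) \<cdot> f)) \<cdot> f'"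
    using cmp_assoc[OF f gh g'] by simp
  finally show ?case by (simp add: uv x)
qed

end

section \<open>Recovering extensional families from restrictions\<close>

text \<open>The components of \<open>action_data_of\<close> are nested restrictions. These lemmas
  identify them with given data from agreement on the domain, since a member of an extensional
  product is \<open>undefined\<close> elsewhere.\<close>

lemma restrict1_eq:
  assumes f: "f \<in> Pi\<^sub>E S T" and eq: "\<And>x. x \<in> S \<Longrightarrow> F x = f x"
  shows "(\<lambda>x \<in> S. F x) = f"
proof
  show "(\<lambda>x \<in> S. F x) x = f x" for x
    by (cases "x \<in> S") (simp_all add: eq PiE_arb[OF f])
qed

lemma restrict2_eq:
  assumes f: "f \<in> (\<Pi>\<^sub>E A \<in> X. \<Pi>\<^sub>E B \<in> X. S A B \<rightarrow>\<^sub>E T A B)"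
    and eq: "\<And>A B x. \<lbrakk>A \<in> X; B \<in> X; x \<in> S A B\<rbrakk> \<Longrightarrow> F A B x = f A B x"
  shows "(\<lambda>A \<in> X. \<lambda>B \<in> X. \<lambda>x \<in> S A B. F A B x) = f"
proof (rule restrict1_eq[OF f])
  fix A assume A: "A \<in> X"
  show "(\<lambda>B \<in> X. \<lambda>x \<in> S A B. F A B x) = f A"
    by (rule restrict1_eq[OF PiE_mem[OF f A]], rule restrict1_eq[OF PiE_mem[OF PiE_mem[OF f A]]])
      (simp_all add: eq A)
qed

lemma restrict3_eq:
  assumes f: "f \<in> (\<Pi>\<^sub>E A \<in> X. \<Pi>\<^sub>E B \<in> X. \<Pi>\<^sub>E C \<in> X. S A B C \<rightarrow>\<^sub>E T A B C)"
    and eq: "\<And>A B C x. \<lbrakk>A \<in> X; B \<in> X; C \<in> X; x \<in> S A B C\<rbrakk> \<Longrightarrow> F A B C x = f A B C x"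
  shows "(\<lambda>A \<in> X. \<lambda>B \<in> X. \<lambda>C \<in> X. \<lambda>x \<in> S A B C. F A B C x) = f"
proof (rule restrict1_eq[OF f])
  fix A assume A: "A \<in> X"
  show "(\<lambda>B \<in> X. \<lambda>C \<in> X. \<lambda>x \<in> S A B C. F A B C x) = f A"
    by (rule restrict2_eq[OF PiE_mem[OF f A]]) (simp add: eq A)
qed

section \<open>From 2-cell structures to actions\<close>

context category
begin

text \<open>The definition splits into the typing of the four maps, which carries all the
  naturality, and equations that can be checked at each (A, B) separately.\<close>

lemma two_cell_structures_iff:
  fixes H :: "('o, 'm, 'h) bifctr"
  shows "(H, d, c, e, m) \<in> two_cell_structures \<C> \<longleftrightarrow>
    internal_category_data (op_prod \<C>) (hom_fctr \<C>) H d c e m \<and>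
    (\<forall>A \<in> Ob \<C>. \<forall>B \<in> Ob \<C>. fibre_category (hom_fctr \<C>) H d c e m (A, B))"
proof -
  let ?data = "internal_category_data (op_prod \<C>) (hom_fctr \<C>) H d c e m"
  have "?data" if "(H, d, c, e, m) \<in> two_cell_structures \<C>"
    using that diagram_shape_op_prod
    by (simp only: two_cell_structures_def mem_Collect_eq prod.case internal_category_def Let_def
        internal_category_data_def internal_category_data_axioms_def simp_thms)
  then show ?thesis
    using internal_category_data.internal_category_iff[of "op_prod \<C>" "hom_fctr \<C>" H d c e m]
    by (auto simp: two_cell_structures_def)
qed

end

locale two_cell_structure = category \<C> for \<C> :: "('o, 'm) cat" (structure) +
  fixes H :: "('o, 'm, 'h) bifctr" and d c e m :: "('o, 'm, 'h) bintrans"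
  assumes in_two_cell_structures: "(H, d, c, e, m) \<in> two_cell_structures \<C>"

sublocale two_cell_structure \<subseteq> data: internal_category_data "op_prod \<C>" "hom_fctr \<C>" H d c e m
  using in_two_cell_structures by (simp add: two_cell_structures_iff)

context two_cell_structure
begin

lemma fibre: "\<lbrakk>A \<in> Ob \<C>; B \<in> Ob \<C>\<rbrakk> \<Longrightarrow> fibre_category (hom_fctr \<C>) H d c e m (A, B)"
  using in_two_cell_structures by (simp add: two_cell_structures_iff)

lemma far_mem:
  assumes "f \<in> hom \<C> A' A" "g \<in> hom \<C> B B'" "x \<in> fob H (A, B)"
  shows "app (far H (f, g)) x \<in> fob H (A', B')"
  using set_functor_far_mem[OF data.is_functor_X(2), of "(f, g)" x] assms by (simp add: homD)

lemma far_idt: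
  "\<lbrakk>A \<in> Ob \<C>; B \<in> Ob \<C>; x \<in> fob H (A, B)\<rbrakk> \<Longrightarrow> app (far H (\<one> A, \<one> B)) x = x"
  using set_functor_far_idt[OF data.is_functor_X(2), of "(A, B)" x] by simp

lemma far_far:
  assumes "f \<in> hom \<C> A' A" "g \<in> hom \<C> B B'" "f' \<in> hom \<C> A'' A'" "g' \<in> hom \<C> B' B''"
    "x \<in> fob H (A, B)"
  shows "app (far H (f', g')) (app (far H (f, g)) x) = app (far H (f \<cdot> f', g' \<cdot> g)) x"
  using set_functor_far_cmp[OF data.is_functor_X(2), of "(f, g)" "(f', g')" x] assms
  by (simp add: homD)

text \<open>Values of the hom functor are arrows tagged by \<open>Mor\<close>, so removing the tag
  with \<open>the_mor\<close> loses nothing.\<close>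

lemma boundary_mem:
  assumes "s \<in> hom data.\<E> H (hom_fctr \<C>)" "A \<in> Ob \<C>" "B \<in> Ob \<C>" "x \<in> fob H (A, B)"
  shows "the_mor (app (at s (A, B)) x) \<in> hom \<C> A B"
    and "Mor (the_mor (app (at s (A, B)) x)) = app (at s (A, B)) x"
  using hom_functor_cat_at_mem[OF assms(1), of "(A, B)" x] assms(2-) by auto

text \<open>Naturality in both variables at once; putting an identity for f or for g gives the
  boundary laws for the left or the right action.\<close>

lemma boundary_far:
  assumes s: "s \<in> hom data.\<E> H (hom_fctr \<C>)"
    and f: "f \<in> hom \<C> A' A" and g: "g \<in> hom \<C> B B'" and x: "x \<in> fob H (A, B)"
  shows "the_mor (app (at s (A', B')) (app (far H (f, g)) x)) =
    (g \<cdot> the_mor (app (at s (A, B)) x)) \<cdot> f"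
proof -
  have AB: "A \<in> Ob \<C>" "B \<in> Ob \<C>" using f g hom_Ob by blast+
  have "app (at s (A', B')) (app (far H (f, g)) x) =
      app (far (hom_fctr \<C>) (f, g)) (Mor (the_mor (app (at s (A, B)) x)))"
    using data.hom_functor_cat_natural[OF s, of "(f, g)" x] f g x
    by (simp add: homD boundary_mem[OF s AB])
  then show ?thesis
    using f g boundary_mem(1)[OF s AB x] by simp
qed

lemma zero_mem: "f \<in> hom \<C> A B \<Longrightarrow> app (at e (A, B)) (Mor f) \<in> fob H (A, B)"
  using data.at_mem(3)[of "(A, B)" "Mor f"] hom_Ob by auto

lemma zero_far:
  assumes "f \<in> hom \<C> A' A" "g \<in> hom \<C> B B'" "h \<in> hom \<C> A B"
  shows "app (far H (f, g)) (app (at e (A, B)) (Mor h)) = app (at e (A', B')) (Mor ((g \<cdot> h) \<cdot> f))"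
  using data.hom_functor_cat_natural[OF data.e_hom, of "(f, g)" "Mor h"] assms
    hom_Ob[OF assms(3)]
  by (simp add: homD)

text \<open>The pullback compares tagged boundaries, \<open>composable\<close> plain ones; on cells
  the two conditions agree.\<close>

lemma cell_in_pb_set:
  assumes "A \<in> Ob \<C>" "B \<in> Ob \<C>"
  shows "Pr x x' \<in> pb_set d c (A, B) \<longleftrightarrow> x \<in> fob H (A, B) \<and> x' \<in> fob H (A, B) \<and>
    the_mor (app (at d (A, B)) x) = the_mor (app (at c (A, B)) x')"
proof (cases "x \<in> fob H (A, B) \<and> x' \<in> fob H (A, B)")
  case True
  then have "app (at d (A, B)) x = app (at c (A, B)) x' \<longleftrightarrow>
      the_mor (app (at d (A, B)) x) = the_mor (app (at c (A, B)) x')"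
    using boundary_mem(2)[OF data.d_hom assms, of x] boundary_mem(2)[OF data.c_hom assms, of x']
    by metis
  with True show ?thesis by (auto simp: data.in_pb_set)
qed (auto simp: data.in_pb_set)

lemma plus_mem:
  "\<lbrakk>A \<in> Ob \<C>; B \<in> Ob \<C>; Pr x x' \<in> pb_set d c (A, B)\<rbrakk>
    \<Longrightarrow> app (at m (A, B)) (Pr x x') \<in> fob H (A, B)"
  using data.m_mem[of "(A, B)"] by simp

lemma plus_far:
  assumes f: "f \<in> hom \<C> A' A" and g: "g \<in> hom \<C> B B'" and x: "Pr x x' \<in> pb_set d c (A, B)"
  shows "app (far H (f, g)) (app (at m (A, B)) (Pr x x')) =
    app (at m (A', B')) (Pr (app (far H (f, g)) x) (app (far H (f, g)) x'))"
proof -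
  have "nsrc d = H" "nsrc c = H"
    using data.d_hom data.c_hom by (simp_all add: in_hom_functor_cat)
  then show ?thesis
    using data.hom_functor_cat_natural[OF data.m_hom, of "(f, g)" "Pr x x'"] f g x
      hom_Ob[OF f] hom_Ob[OF g]
    by (simp add: homD)
qed

text \<open>This and the next six definitions name the components of \<open>action_data_of\<close>
  at the fixed structure, so that evaluation rules can be stated for each one.\<close>

definition "cells = (\<lambda>A \<in> Ob \<C>. \<lambda>B \<in> Ob \<C>. fob H (A, B))"
definition "cell_dom = (\<lambda>A \<in> Ob \<C>. \<lambda>B \<in> Ob \<C>. \<lambda>x \<in> fob H (A, B). the_mor (app (at d (A, B)) x))"
definition "cell_cod = (\<lambda>A \<in> Ob \<C>. \<lambda>B \<in> Ob \<C>. \<lambda>x \<in> fob H (A, B). the_mor (app (at c (A, B)) x))"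
definition "cell_zero = (\<lambda>A \<in> Ob \<C>. \<lambda>B \<in> Ob \<C>. \<lambda>f \<in> hom \<C> A B. app (at e (A, B)) (Mor f))"
definition "cell_plus = (\<lambda>A \<in> Ob \<C>. \<lambda>B \<in> Ob \<C>.
  \<lambda>(x, x') \<in> {(x, x') \<in> fob H (A, B) \<times> fob H (A, B).
                app (at d (A, B)) x = app (at c (A, B)) x'}. app (at m (A, B)) (Pr x x'))"
definition "cell_ract = (\<lambda>A \<in> Ob \<C>. \<lambda>B \<in> Ob \<C>. \<lambda>C \<in> Ob \<C>. \<lambda>(x, f) \<in> fob H (B, C) \<times> hom \<C> A B.
  app (far H (f, \<one> C)) x)"
definition "cell_lact = (\<lambda>A \<in> Ob \<C>. \<lambda>B \<in> Ob \<C>. \<lambda>C \<in> Ob \<C>. \<lambda>(g, y) \<in> hom \<C> B C \<times> fob H (A, B).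
  app (far H (\<one> A, g)) y)"

lemmas cell_defs = cells_def cell_dom_def cell_cod_def cell_zero_def cell_plus_def cell_ract_def
  cell_lact_def

lemma action_data_of_eq:
  "action_data_of \<C> (H, d, c, e, m) =
    (cells, cell_dom, cell_cod, cell_zero, cell_plus, cell_ract, cell_lact)"
  by (simp add: action_data_of_def cell_defs)

lemma cell_simps [simp]:
  assumes "A \<in> Ob \<C>" "B \<in> Ob \<C>"
  shows "cells A B = fob H (A, B)"
    and "x \<in> fob H (A, B) \<Longrightarrow> cell_dom A B x = the_mor (app (at d (A, B)) x)"
    and "x \<in> fob H (A, B) \<Longrightarrow> cell_cod A B x = the_mor (app (at c (A, B)) x)"
    and "f \<in> hom \<C> A B \<Longrightarrow> cell_zero A B f = app (at e (A, B)) (Mor f)"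
    and "(x, x') \<in> composable cells cell_dom cell_cod A B \<longleftrightarrow> Pr x x' \<in> pb_set d c (A, B)"
    and "Pr x x' \<in> pb_set d c (A, B) \<Longrightarrow> cell_plus A B (x, x') = app (at m (A, B)) (Pr x x')"
    and "\<lbrakk>C \<in> Ob \<C>; x \<in> fob H (B, C); f \<in> hom \<C> A B\<rbrakk>
      \<Longrightarrow> cell_ract A B C (x, f) = app (far H (f, \<one> C)) x"
    and "\<lbrakk>C \<in> Ob \<C>; g \<in> hom \<C> B C; y \<in> fob H (A, B)\<rbrakk>
      \<Longrightarrow> cell_lact A B C (g, y) = app (far H (\<one> A, g)) y"
  using assms cell_in_pb_set[OF assms, of x x']
  by (auto simp: cell_defs composable_def data.in_pb_set)

lemma two_cell_actions:
  "two_cell_actions \<C> cells cell_dom cell_cod cell_zero cell_plus cell_ract cell_lact"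
proof
  show "cells \<in> Ob \<C> \<rightarrow>\<^sub>E Ob \<C> \<rightarrow>\<^sub>E UNIV"
    by (simp add: cells_def)
  show "cell_dom \<in> (\<Pi>\<^sub>E A \<in> Ob \<C>. \<Pi>\<^sub>E B \<in> Ob \<C>. cells A B \<rightarrow>\<^sub>E hom \<C> A B)"
    by (auto simp: cell_dom_def cells_def boundary_mem[OF data.d_hom])
  show "cell_cod \<in> (\<Pi>\<^sub>E A \<in> Ob \<C>. \<Pi>\<^sub>E B \<in> Ob \<C>. cells A B \<rightarrow>\<^sub>E hom \<C> A B)"
    by (auto simp: cell_cod_def cells_def boundary_mem[OF data.c_hom])
  show "cell_zero \<in> (\<Pi>\<^sub>E A \<in> Ob \<C>. \<Pi>\<^sub>E B \<in> Ob \<C>. hom \<C> A B \<rightarrow>\<^sub>E cells A B)"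
    by (auto simp: cell_zero_def cells_def zero_mem)
  \<comment> \<open>The domain of \<open>cell_plus\<close> is cut out by tagged boundaries, whereas
    its required type speaks of \<open>composable\<close>; the two sets have to be identified
    first.\<close>
  have comp_eq: "composable cells cell_dom cell_cod A B = {(x, x') \<in> fob H (A, B) \<times> fob H (A, B).
      app (at d (A, B)) x = app (at c (A, B)) x'}" if "A \<in> Ob \<C>" "B \<in> Ob \<C>" for A B
    using that by (auto simp: data.in_pb_set)
  show "cell_plus \<in> (\<Pi>\<^sub>E A \<in> Ob \<C>. \<Pi>\<^sub>E B \<in> Ob \<C>. composable cells cell_dom cell_cod A B \<rightarrow>\<^sub>E cells A B)"
    by (auto simp: comp_eq cell_plus_def data.in_pb_set intro!: plus_mem)
  show "cell_ract \<in> (\<Pi>\<^sub>E A \<in> Ob \<C>. \<Pi>\<^sub>E B \<in> Ob \<C>. \<Pi>\<^sub>E C \<in> Ob \<C>. cells B C \<times> hom \<C> A B \<rightarrow>\<^sub>E cells A C)"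
    by (auto simp: cell_ract_def cells_def split: if_splits intro: far_mem[OF _ idt_hom])
  show "cell_lact \<in> (\<Pi>\<^sub>E A \<in> Ob \<C>. \<Pi>\<^sub>E B \<in> Ob \<C>. \<Pi>\<^sub>E C \<in> Ob \<C>. hom \<C> B C \<times> cells A B \<rightarrow>\<^sub>E cells A C)"
    by (auto simp: cell_lact_def cells_def split: if_splits intro: far_mem[OF idt_hom])
next
  fix A B C g y assume *: "A \<in> Ob \<C>" "B \<in> Ob \<C>" "C \<in> Ob \<C>" "g \<in> hom \<C> B C" "y \<in> cells A B"
  then have y: "y \<in> fob H (A, B)" by simp
  note far = far_mem[OF idt_hom[OF *(1)] *(4) y]
  show "cell_dom A C (cell_lact A B C (g, y)) = g \<cdot> cell_dom A B y"
    using * y far boundary_mem(1)[OF data.d_hom *(1,2) y]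
    by (simp add: boundary_far[OF data.d_hom idt_hom[OF *(1)] *(4) y] cmp_idt_right[OF cmp_hom])
  show "cell_cod A C (cell_lact A B C (g, y)) = g \<cdot> cell_cod A B y"
    using * y far boundary_mem(1)[OF data.c_hom *(1,2) y]
    by (simp add: boundary_far[OF data.c_hom idt_hom[OF *(1)] *(4) y] cmp_idt_right[OF cmp_hom])
next
  fix A B C x f assume *: "A \<in> Ob \<C>" "B \<in> Ob \<C>" "C \<in> Ob \<C>" "x \<in> cells B C" "f \<in> hom \<C> A B"
  then have x: "x \<in> fob H (B, C)" by simp
  note far = far_mem[OF *(5) idt_hom[OF *(3)] x]
  show "cell_dom A C (cell_ract A B C (x, f)) = cell_dom B C x \<cdot> f"
    using * x far boundary_mem(1)[OF data.d_hom *(2,3) x]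
    by (simp add: boundary_far[OF data.d_hom *(5) idt_hom[OF *(3)] x] cmp_idt_left)
  show "cell_cod A C (cell_ract A B C (x, f)) = cell_cod B C x \<cdot> f"
    using * x far boundary_mem(1)[OF data.c_hom *(2,3) x]
    by (simp add: boundary_far[OF data.c_hom *(5) idt_hom[OF *(3)] x] cmp_idt_left)
next
  fix A B C g f assume *: "A \<in> Ob \<C>" "B \<in> Ob \<C>" "C \<in> Ob \<C>" "g \<in> hom \<C> B C" "f \<in> hom \<C> A B"
  note gf = cmp_hom[OF *(5,4)]
  show "cell_lact A B C (g, cell_zero A B f) = cell_zero A C (g \<cdot> f)"
    using * gf zero_mem[OF *(5)]
    by (simp add: zero_far[OF idt_hom[OF *(1)] *(4,5)] cmp_idt_right)
  show "cell_zero A C (g \<cdot> f) = cell_ract A B C (cell_zero B C g, f)"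
    using * gf zero_mem[OF *(4)]
    by (simp add: zero_far[OF *(5) idt_hom[OF *(3)] *(4)] cmp_idt_left)
next
  fix A B C x x' f assume *: "A \<in> Ob \<C>" "B \<in> Ob \<C>" "C \<in> Ob \<C>"
    "(x, x') \<in> composable cells cell_dom cell_cod B C" "f \<in> hom \<C> A B"
  then have pb: "Pr x x' \<in> pb_set d c (B, C)" by simp
  then have x: "x \<in> fob H (B, C)" "x' \<in> fob H (B, C)" using * by (simp_all add: cell_in_pb_set)
  note 1 = idt_hom[OF *(3)]
  \<comment> \<open>The transported pair must be shown composable before the sum on the right can be
    evaluated.\<close>
  have "Pr (app (far H (f, \<one> C)) x) (app (far H (f, \<one> C)) x') \<in> pb_set d c (A, C)"
    using pb * far_mem[OF *(5) 1] x
    by (simp add: cell_in_pb_set boundary_far[OF data.d_hom *(5) 1] boundary_far[OF data.c_hom *(5) 1])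
  then show "cell_ract A B C (cell_plus B C (x, x'), f) =
      cell_plus A C (cell_ract A B C (x, f), cell_ract A B C (x', f))"
    using * pb x plus_mem[OF *(2,3) pb] by (simp add: plus_far[OF *(5) 1 pb])
next
  fix A B C g y y' assume *: "A \<in> Ob \<C>" "B \<in> Ob \<C>" "C \<in> Ob \<C>" "g \<in> hom \<C> B C"
    "(y, y') \<in> composable cells cell_dom cell_cod A B"
  then have pb: "Pr y y' \<in> pb_set d c (A, B)" by simp
  then have y: "y \<in> fob H (A, B)" "y' \<in> fob H (A, B)" using * by (simp_all add: cell_in_pb_set)
  note 1 = idt_hom[OF *(1)]
  have "Pr (app (far H (\<one> A, g)) y) (app (far H (\<one> A, g)) y') \<in> pb_set d c (A, C)"
    using pb * far_mem[OF 1 *(4)] y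
    by (simp add: cell_in_pb_set boundary_far[OF data.d_hom 1 *(4)] boundary_far[OF data.c_hom 1 *(4)])
  then show "cell_lact A B C (g, cell_plus A B (y, y')) =
      cell_plus A C (cell_lact A B C (g, y), cell_lact A B C (g, y'))"
    using * pb y plus_mem[OF *(1,2) pb] by (simp add: plus_far[OF 1 *(4) pb])
next
  fix A B C D g' g y assume *: "A \<in> Ob \<C>" "B \<in> Ob \<C>" "C \<in> Ob \<C>" "D \<in> Ob \<C>"
    "g' \<in> hom \<C> C D" "g \<in> hom \<C> B C" "y \<in> cells A B"
  then have y: "y \<in> fob H (A, B)" by simp
  note 1 = idt_hom[OF *(1)]
  show "cell_lact A C D (g', cell_lact A B C (g, y)) = cell_lact A B D (g' \<cdot> g, y)"
    using * y far_mem[OF 1 *(6) y] cmp_hom[OF *(6,5)]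
    by (simp add: far_far[OF 1 *(6) 1 *(5) y] cmp_idt_right[OF 1])
next
  fix A B C D x f f' assume *: "A \<in> Ob \<C>" "B \<in> Ob \<C>" "C \<in> Ob \<C>" "D \<in> Ob \<C>"
    "x \<in> cells C D" "f \<in> hom \<C> B C" "f' \<in> hom \<C> A B"
  then have x: "x \<in> fob H (C, D)" by simp
  note 1 = idt_hom[OF *(4)]
  show "cell_ract A B D (cell_ract B C D (x, f), f') = cell_ract A C D (x, f \<cdot> f')"
    using * x far_mem[OF *(6) 1 x] cmp_hom[OF *(7,6)]
    by (simp add: far_far[OF *(6) 1 *(7) 1 x] cmp_idt_right[OF 1])
next
  fix A B C D g' x f assume *: "A \<in> Ob \<C>" "B \<in> Ob \<C>" "C \<in> Ob \<C>" "D \<in> Ob \<C>"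
    "g' \<in> hom \<C> C D" "x \<in> cells B C" "f \<in> hom \<C> A B"
  then have x: "x \<in> fob H (B, C)" by simp
  note 1 = idt_hom[OF *(1)] idt_hom[OF *(2)] idt_hom[OF *(3)] idt_hom[OF *(4)]
  \<comment> \<open>By functoriality, H(1, g') H(f, 1) and H(f, 1) H(1, g') both equal H(f,
    g').\<close>
  show "cell_lact A C D (g', cell_ract A B C (x, f)) = cell_ract A B D (cell_lact B C D (g', x), f)"
    using * x far_mem[OF *(7) 1(3) x] far_mem[OF 1(2) *(5) x]
    by (simp add: far_far[OF *(7) 1(3) 1(1) *(5) x] far_far[OF 1(2) *(5) *(7) 1(4) x]
        cmp_idt_left[OF *(5)] cmp_idt_left[OF *(7)] cmp_idt_right[OF *(5)] cmp_idt_right[OF *(7)])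
next
  fix B C x assume *: "B \<in> Ob \<C>" "C \<in> Ob \<C>" "x \<in> cells B C"
  then show "cell_lact B C C (\<one> C, x) = x" "cell_ract B B C (x, \<one> B) = x"
    by (simp_all add: idt_hom far_idt)
next
  fix A B f assume *: "A \<in> Ob \<C>" "B \<in> Ob \<C>" "f \<in> hom \<C> A B"
  then show "cell_dom A B (cell_zero A B f) = f" "cell_cod A B (cell_zero A B f) = f"
    using fibre[OF *(1,2)] by (simp_all add: zero_mem fibre_category_def)
next
  fix A B x x' assume *: "A \<in> Ob \<C>" "B \<in> Ob \<C>" "(x, x') \<in> composable cells cell_dom cell_cod A B"
  then have pb: "Pr x x' \<in> pb_set d c (A, B)" by simp
  with * have "x \<in> fob H (A, B)" "x' \<in> fob H (A, B)" by (simp_all add: cell_in_pb_set)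
  with * pb show "cell_dom A B (cell_plus A B (x, x')) = cell_dom A B x'"
    "cell_cod A B (cell_plus A B (x, x')) = cell_cod A B x"
    using fibre[OF *(1,2)] plus_mem[OF *(1,2) pb] by (simp_all add: fibre_category_def)
next
  fix A B x assume *: "A \<in> Ob \<C>" "B \<in> Ob \<C>" "x \<in> cells A B"
  then have x: "x \<in> fob H (A, B)" by simp
  note mem = boundary_mem[OF data.d_hom *(1,2) x] boundary_mem[OF data.c_hom *(1,2) x]
  note unit = fibre[OF *(1,2), unfolded fibre_category_def] zero_mem[OF mem(1)] zero_mem[OF mem(3)]
  \<comment> \<open>The boundaries of the identity cells make (0, x) and (x, 0) composable, after
    which the fibrewise unit laws apply.\<close>
  have "the_mor (app (at d (A, B)) (app (at e (A, B)) (Mor (the_mor (app (at c (A, B)) x))))) =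
      the_mor (app (at c (A, B)) x)"
    "the_mor (app (at c (A, B)) (app (at e (A, B)) (Mor (the_mor (app (at d (A, B)) x))))) =
      the_mor (app (at d (A, B)) x)"
    using unit(1) mem(1,3) * by simp_all
  then show "cell_plus A B (cell_zero A B (cell_cod A B x), x) = x"
    "cell_plus A B (x, cell_zero A B (cell_dom A B x)) = x"
    using * x mem unit by (simp_all add: cell_in_pb_set)
next
  fix A B x x' x'' assume *: "A \<in> Ob \<C>" "B \<in> Ob \<C>"
    "(x, x') \<in> composable cells cell_dom cell_cod A B"
    "(x', x'') \<in> composable cells cell_dom cell_cod A B"
  then have pb: "Pr x x' \<in> pb_set d c (A, B)" "Pr x' x'' \<in> pb_set d c (A, B)" by simp_all
  \<comment> \<open>The boundary laws for sums make the outer pairs of both bracketings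
    composable.\<close>
  then have "Pr x (app (at m (A, B)) (Pr x' x'')) \<in> pb_set d c (A, B)"
    "Pr (app (at m (A, B)) (Pr x x')) x'' \<in> pb_set d c (A, B)"
    using fibre[OF *(1,2), unfolded fibre_category_def] plus_mem[OF *(1,2)] *
    by (simp_all add: cell_in_pb_set)
  then show "cell_plus A B (x, cell_plus A B (x', x'')) = cell_plus A B (cell_plus A B (x, x'), x'')"
    using fibre[OF *(1,2), unfolded fibre_category_def] * pb by simp
qed

end

section \<open>From actions to 2-cell structures\<close>

text \<open>The element type is the universe in which a \<open>bifctr\<close> takes its values, so
  the sets \<open>H A B\<close> can serve unchanged as values of a functor.\<close>

locale elt_actions = two_cell_actions \<C> H cdom ccod zero plus ract lact
  for \<C> :: "('o, 'm) cat" (structure) and H :: "'o \<Rightarrow> 'o \<Rightarrow> ('m, 'h) elt set"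
    and cdom ccod zero plus ract lact
begin

lemma cdom_mem: "\<lbrakk>A \<in> Ob \<C>; B \<in> Ob \<C>; x \<in> H A B\<rbrakk> \<Longrightarrow> cdom A B x \<in> hom \<C> A B"
  and ccod_mem: "\<lbrakk>A \<in> Ob \<C>; B \<in> Ob \<C>; x \<in> H A B\<rbrakk> \<Longrightarrow> ccod A B x \<in> hom \<C> A B"
  and zero_mem: "\<lbrakk>A \<in> Ob \<C>; B \<in> Ob \<C>; f \<in> hom \<C> A B\<rbrakk> \<Longrightarrow> zero A B f \<in> H A B"
  and plus_mem: "\<lbrakk>A \<in> Ob \<C>; B \<in> Ob \<C>; (x, x') \<in> composable H cdom ccod A B\<rbrakk>
    \<Longrightarrow> plus A B (x, x') \<in> H A B"
  using PiE_mem[OF PiE_mem[OF PiE_mem[OF cdom_type]]] PiE_mem[OF PiE_mem[OF PiE_mem[OF ccod_type]]]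
    PiE_mem[OF PiE_mem[OF PiE_mem[OF zero_type]]] PiE_mem[OF PiE_mem[OF PiE_mem[OF plus_type]]]
  by blast+

lemma ract_mem:
  assumes "x \<in> H B C" "f \<in> hom \<C> A B" "C \<in> Ob \<C>"
  shows "ract A B C (x, f) \<in> H A C"
  using PiE_mem[OF PiE_mem[OF PiE_mem[OF PiE_mem[OF ract_type]]], of A B C "(x, f)"] assms
    hom_Ob[OF assms(2)] by simp

lemma lact_mem:
  assumes "g \<in> hom \<C> B C" "y \<in> H A B" "A \<in> Ob \<C>"
  shows "lact A B C (g, y) \<in> H A C"
  using PiE_mem[OF PiE_mem[OF PiE_mem[OF PiE_mem[OF lact_type]]], of A B C "(g, y)"] assms
    hom_Ob[OF assms(1)] by simp

text \<open>This is H(f, g)(x) = g (x f). The actions are indexed by objects, but the arrow part of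
  a functor sees only f and g, so the objects are read off from their sources and targets.\<close>

definition "act f g x = lact (src \<C> f) (src \<C> g) (tgt \<C> g) (g, ract (src \<C> f) (tgt \<C> f) (src \<C> g) (x, f))"

lemma act_eq:
  "\<lbrakk>f \<in> hom \<C> A' A; g \<in> hom \<C> B B'\<rbrakk> \<Longrightarrow> act f g x = lact A' B B' (g, ract A' A B (x, f))"
  by (simp add: act_def homD)

lemma act_mem:
  assumes "f \<in> hom \<C> A' A" "g \<in> hom \<C> B B'" "x \<in> H A B"
  shows "act f g x \<in> H A' B'"
  using assms hom_Ob[OF assms(1)] hom_Ob[OF assms(2)] by (simp add: act_eq lact_mem ract_mem)

text \<open>In g' ((g (x f)) f') the law \<open>lact_ract\<close> moves f' past g; then the two
  right actions and the two left actions merge separately.\<close>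

lemma act_act:
  assumes f: "f \<in> hom \<C> A' A" and g: "g \<in> hom \<C> B B'"
    and f': "f' \<in> hom \<C> A'' A'" and g': "g' \<in> hom \<C> B' B''" and x: "x \<in> H A B"
  shows "act (f \<cdot> f') (g' \<cdot> g) x = act f' g' (act f g x)"
proof -
  note obs = hom_Ob[OF f] hom_Ob[OF g] hom_Ob[OF f'] hom_Ob[OF g']
  note xf = ract_mem[OF x f obs(3)]
  have "act f' g' (act f g x) =
      lact A'' B' B'' (g', ract A'' A' B' (lact A' B B' (g, ract A' A B (x, f)), f'))"
    using f g f' g' by (simp add: act_eq)
  also have "\<dots> = lact A'' B' B'' (g', lact A'' B B' (g, ract A'' A' B (ract A' A B (x, f), f')))"
    using lact_ract[OF _ _ _ _ g xf f'] obs by simp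
  also have "\<dots> = lact A'' B' B'' (g', lact A'' B B' (g, ract A'' A B (x, f \<cdot> f')))"
    using ract_ract[OF _ _ _ _ x f f'] obs by simp
  also have "\<dots> = lact A'' B B'' (g' \<cdot> g, ract A'' A B (x, f \<cdot> f'))"
    using lact_lact[OF _ _ _ _ g' g ract_mem[OF x cmp_hom[OF f' f] obs(3)]] obs by simp
  also have "\<dots> = act (f \<cdot> f') (g' \<cdot> g) x"
    using act_eq[OF cmp_hom[OF f' f] cmp_hom[OF g g']] by simp
  finally show ?thesis by simp
qed

lemma boundary_act:
  assumes f: "f \<in> hom \<C> A' A" and g: "g \<in> hom \<C> B B'" and x: "x \<in> H A B"
  shows "cdom A' B' (act f g x) = (g \<cdot> cdom A B x) \<cdot> f"
    and "ccod A' B' (act f g x) = (g \<cdot> ccod A B x) \<cdot> f"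
proof -
  note obs = hom_Ob[OF f] hom_Ob[OF g]
  show "cdom A' B' (act f g x) = (g \<cdot> cdom A B x) \<cdot> f"
    using obs f g x ract_mem[OF x f] cmp_assoc[OF f cdom_mem[OF obs(2,3) x] g]
    by (simp add: act_eq cdom_lact cdom_ract)
  show "ccod A' B' (act f g x) = (g \<cdot> ccod A B x) \<cdot> f"
    using obs f g x ract_mem[OF x f] cmp_assoc[OF f ccod_mem[OF obs(2,3) x] g]
    by (simp add: act_eq ccod_lact ccod_ract)
qed

lemma act_zero:
  assumes f: "f \<in> hom \<C> A' A" and g: "g \<in> hom \<C> B B'" and h: "h \<in> hom \<C> A B"
  shows "act f g (zero A B h) = zero A' B' ((g \<cdot> h) \<cdot> f)"
proof -
  note obs = hom_Ob[OF f] hom_Ob[OF g]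
  have "act f g (zero A B h) = lact A' B B' (g, zero A' B (h \<cdot> f))"
    using ract_zero[OF _ _ _ h f] obs f g by (simp add: act_eq)
  also have "\<dots> = zero A' B' (g \<cdot> (h \<cdot> f))"
    using lact_zero[OF _ _ _ g cmp_hom[OF f h]] obs by simp
  finally show ?thesis using cmp_assoc[OF f h g] by simp
qed

lemma act_plus:
  assumes f: "f \<in> hom \<C> A' A" and g: "g \<in> hom \<C> B B'"
    and x: "(x, x') \<in> composable H cdom ccod A B"
  shows "act f g (plus A B (x, x')) = plus A' B' (act f g x, act f g x')"
proof -
  note obs = hom_Ob[OF f] hom_Ob[OF g]
  \<comment> \<open>\<open>lact_plus\<close> is applied after \<open>ract_plus\<close>, so it needs
    composability of the pair already acted on by f.\<close>
  have "(ract A' A B (x, f), ract A' A B (x', f)) \<in> composable H cdom ccod A' B"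
    using x obs f by (auto simp: composable_def ract_mem cdom_ract ccod_ract)
  then show ?thesis
    using obs f g x by (simp add: act_eq ract_plus lact_plus)
qed

definition cell_fctr :: "('o, 'm, 'h) bifctr" where
  "cell_fctr = set_fctr_of (op_prod \<C>) (\<lambda>(A, B). H A B) (\<lambda>(f, g). act f g)"
definition dom_nt :: "('o, 'm, 'h) bintrans" where
  "dom_nt = set_ntrans_of (op_prod \<C>) cell_fctr (hom_fctr \<C>) (\<lambda>(A, B) x. Mor (cdom A B x))"
definition cod_nt :: "('o, 'm, 'h) bintrans" where
  "cod_nt = set_ntrans_of (op_prod \<C>) cell_fctr (hom_fctr \<C>) (\<lambda>(A, B) x. Mor (ccod A B x))"
definition zero_nt :: "('o, 'm, 'h) bintrans" where
  "zero_nt = set_ntrans_of (op_prod \<C>) (hom_fctr \<C>) cell_fctr (\<lambda>(A, B) f. zero A B (the_mor f))"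
definition plus_nt :: "('o, 'm, 'h) bintrans" where
  "plus_nt = set_ntrans_of (op_prod \<C>) (pb_fctr (op_prod \<C>) dom_nt cod_nt) cell_fctr
    (\<lambda>(A, B) z. plus A B (pr1 z, pr2 z))"

lemma fob_cell_fctr [simp]: "\<lbrakk>A \<in> Ob \<C>; B \<in> Ob \<C>\<rbrakk> \<Longrightarrow> fob cell_fctr (A, B) = H A B"
  by (simp add: cell_fctr_def)

lemma app_far_cell_fctr [simp]:
  "\<lbrakk>f \<in> hom \<C> A' A; g \<in> hom \<C> B B'; x \<in> H A B\<rbrakk> \<Longrightarrow> app (far cell_fctr (f, g)) x = act f g x"
  by (simp add: cell_fctr_def homD)

lemma app_nt [simp]:
  assumes "A \<in> Ob \<C>" "B \<in> Ob \<C>"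
  shows "x \<in> H A B \<Longrightarrow> app (at dom_nt (A, B)) x = Mor (cdom A B x)"
    and "x \<in> H A B \<Longrightarrow> app (at cod_nt (A, B)) x = Mor (ccod A B x)"
    and "f \<in> hom \<C> A B \<Longrightarrow> app (at zero_nt (A, B)) (Mor f) = zero A B f"
    and "Pr x x' \<in> pb_set dom_nt cod_nt (A, B) \<Longrightarrow> app (at plus_nt (A, B)) (Pr x x') = plus A B (x, x')"
  using assms by (simp_all add: dom_nt_def cod_nt_def zero_nt_def plus_nt_def)

text \<open>Injectivity of \<open>Mor\<close> turns equality of the tagged boundaries into the
  condition of \<open>composable\<close>.\<close>

lemma pb_set_nt:
  assumes "A \<in> Ob \<C>" "B \<in> Ob \<C>"
  shows "Pr x x' \<in> pb_set dom_nt cod_nt (A, B) \<longleftrightarrow> (x, x') \<in> composable H cdom ccod A B"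
proof -
  have "nsrc dom_nt = cell_fctr" "nsrc cod_nt = cell_fctr"
    by (simp_all add: dom_nt_def cod_nt_def)
  then show ?thesis
    using assms by (auto simp: pb_set_def composable_def)
qed

lemma is_functor_cell_fctr: "is_functor (op_prod \<C>) set_cat cell_fctr"
  unfolding cell_fctr_def
proof (rule diagram_shape.is_functor_set_fctr_of[OF diagram_shape_op_prod], goal_cases)
  case (1 u x)
  then show ?case
    by (cases u) (auto intro: act_mem in_hom_src_tgt)
next
  case (2 j x)
  then show ?case
    by (cases j) (auto simp: act_eq[OF idt_hom idt_hom] lact_idt ract_idt)
next
  case (3 u v x)
  obtain f g f' g' where uv: "u = (f, g)" "v = (f', g')" by (metis surj_pair)
  have "f \<in> hom \<C> (src \<C> f) (tgt \<C> f)" "g \<in> hom \<C> (src \<C> g) (tgt \<C> g)"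
    "f' \<in> hom \<C> (src \<C> f') (src \<C> f)" "g' \<in> hom \<C> (tgt \<C> g) (tgt \<C> g')"
    using 3 uv by (auto simp: hom_def)
  from act_act[OF this] show ?case using 3 uv by simp
qed

text \<open>Naturality on pairs, with the components of objects and arrows separated. The objects
  are offered as hypotheses of the naturality condition because evaluation rules such as
  \<open>app_nt\<close> and \<open>fob_hom_fctr\<close> depend on them.\<close>

lemma ntI:
  assumes "is_functor (op_prod \<C>) set_cat F" "is_functor (op_prod \<C>) set_cat G"
    and "\<And>A B x. \<lbrakk>A \<in> Ob \<C>; B \<in> Ob \<C>; x \<in> fob F (A, B)\<rbrakk> \<Longrightarrow> t A B x \<in> fob G (A, B)"
    and "\<And>A A' B B' f g x. \<lbrakk>f \<in> hom \<C> A' A; g \<in> hom \<C> B B'; A \<in> Ob \<C>; A' \<in> Ob \<C>; B \<in> Ob \<C>; B' \<in> Ob \<C>;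
      x \<in> fob F (A, B)\<rbrakk>
      \<Longrightarrow> t A' B' (app (far F (f, g)) x) = app (far G (f, g)) (t A B x)"
  shows "set_ntrans_of (op_prod \<C>) F G (\<lambda>(A, B). t A B) \<in> hom (functor_cat (op_prod \<C>) set_cat) F G"
proof -
  have "is_ntrans (op_prod \<C>) set_cat (set_ntrans_of (op_prod \<C>) F G (\<lambda>(A, B). t A B))"
  proof (rule diagram_shape.is_ntrans_set_ntrans_of[OF diagram_shape_op_prod assms(1,2)], goal_cases)
    case (1 j x)
    then show ?case using assms(3) by auto
  next
    case (2 u x)
    obtain f g where u: "u = (f, g)" by (metis surj_pair)
    with 2 show ?case
      using assms(4)[OF in_hom_src_tgt in_hom_src_tgt, of f g x] by (simp add: src_Ob tgt_Ob)
  qed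
  then show ?thesis by (simp add: in_hom_functor_cat)
qed

lemma internal_category_data:
  "internal_category_data (op_prod \<C>) (hom_fctr \<C>) cell_fctr dom_nt cod_nt zero_nt plus_nt"
proof (intro internal_category_data.intro internal_category_data_axioms.intro diagram_shape_op_prod)
  let ?E = "functor_cat (op_prod \<C>) set_cat :: (('o, 'm, 'h) bifctr, ('o, 'm, 'h) bintrans) cat"
  note functors = is_functor_cell_fctr is_functor_hom_fctr
  show d: "dom_nt \<in> hom ?E cell_fctr (hom_fctr \<C>)"
    unfolding dom_nt_def using functors
    by (rule ntI) (simp_all add: cdom_mem boundary_act)
  show c: "cod_nt \<in> hom ?E cell_fctr (hom_fctr \<C>)"
    unfolding cod_nt_def using functors
    by (rule ntI) (simp_all add: ccod_mem boundary_act)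
  show "zero_nt \<in> hom ?E (hom_fctr \<C>) cell_fctr"
    unfolding zero_nt_def using functors(2,1)
    by (rule ntI) (auto simp: zero_mem act_zero)
  have pb: "is_functor (op_prod \<C>) set_cat (pb_fctr (op_prod \<C>) dom_nt cod_nt)"
    using d c by (intro diagram_shape.is_functor_pb_fctr[OF diagram_shape_op_prod])
      (simp_all add: in_hom_functor_cat)
  have fob_pb: "z \<in> fob (pb_fctr (op_prod \<C>) dom_nt cod_nt) (A, B) \<longleftrightarrow>
      (\<exists>x x'. z = Pr x x' \<and> (x, x') \<in> composable H cdom ccod A B)" if "A \<in> Ob \<C>" "B \<in> Ob \<C>" for z A B
    using pb_set_nt[OF that] that by (auto simp: pb_set_def)
  show "plus_nt \<in> hom ?E (pb_fctr (op_prod \<C>) dom_nt cod_nt) cell_fctr"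
    unfolding plus_nt_def using pb functors(1)
  proof (rule ntI)
    fix A B z
    assume AB: "A \<in> Ob \<C>" "B \<in> Ob \<C>" and z: "z \<in> fob (pb_fctr (op_prod \<C>) dom_nt cod_nt) (A, B)"
    from z obtain x x' where "z = Pr x x'" "(x, x') \<in> composable H cdom ccod A B"
      using fob_pb[OF AB] by blast
    with AB show "plus A B (pr1 z, pr2 z) \<in> fob cell_fctr (A, B)"
      by (simp add: plus_mem)
  next
    fix A A' B B' f g z
    assume f: "f \<in> hom \<C> A' A" and g: "g \<in> hom \<C> B B'"
      and obs: "A \<in> Ob \<C>" "A' \<in> Ob \<C>" "B \<in> Ob \<C>" "B' \<in> Ob \<C>"
      and z: "z \<in> fob (pb_fctr (op_prod \<C>) dom_nt cod_nt) (A, B)"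
    from z obtain x x' where z': "z = Pr x x'" and x: "(x, x') \<in> composable H cdom ccod A B"
      using fob_pb obs by auto
    have "x \<in> H A B" "x' \<in> H A B" using x by (auto simp: composable_def)
    moreover have "nsrc dom_nt = cell_fctr" "nsrc cod_nt = cell_fctr"
      using d c by (simp_all add: in_hom_functor_cat)
    \<comment> \<open>The pullback functor acts componentwise, so naturality of the sum is precisely
      \<open>act_plus\<close>.\<close>
    ultimately have "app (far (pb_fctr (op_prod \<C>) dom_nt cod_nt) (f, g)) z = Pr (act f g x) (act f g x')"
      using z z' f g obs by (simp add: homD app_far_cell_fctr[OF f g])
    then show "plus A' B' (pr1 (app (far (pb_fctr (op_prod \<C>) dom_nt cod_nt) (f, g)) z),
        pr2 (app (far (pb_fctr (op_prod \<C>) dom_nt cod_nt) (f, g)) z)) =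
        app (far cell_fctr (f, g)) (plus A B (pr1 z, pr2 z))"
      using z' x f g obs by (simp add: plus_mem act_plus app_far_cell_fctr[OF f g])
  qed
qed

text \<open>Each case is one law of condition (3). Where a sum is formed with a zero or with another
  sum, composability comes first, because \<open>plus_nt\<close> can be evaluated only on the
  pullback.\<close>

lemma fibre_category:
  assumes obs: "A \<in> Ob \<C>" "B \<in> Ob \<C>"
  shows "fibre_category (hom_fctr \<C>) cell_fctr dom_nt cod_nt zero_nt plus_nt (A, B)"
  unfolding fibre_category_def
proof (intro conjI allI ballI impI, goal_cases)
  case (1 f)
  then show ?case using obs by (auto simp: zero_mem cdom_zero)
next
  case (2 f)
  then show ?case using obs by (auto simp: zero_mem ccod_zero)
next
  case (3 x)
  then have "(zero A B (ccod A B x), x) \<in> composable H cdom ccod A B"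
    using obs by (simp add: composable_def zero_mem ccod_mem cdom_zero)
  with 3 show ?case using obs by (simp add: ccod_mem pb_set_nt zero_plus)
next
  case (4 x)
  then have "(x, zero A B (cdom A B x)) \<in> composable H cdom ccod A B"
    using obs by (simp add: composable_def zero_mem cdom_mem ccod_zero)
  with 4 show ?case using obs by (simp add: cdom_mem pb_set_nt plus_zero)
next
  case (5 x x')
  then have x: "(x, x') \<in> composable H cdom ccod A B" using obs by (simp add: pb_set_nt)
  then have "x' \<in> H A B" by (simp add: composable_def)
  with 5 x show ?case using obs by (simp add: plus_mem cdom_plus)
next
  case (6 x x')
  then have x: "(x, x') \<in> composable H cdom ccod A B" using obs by (simp add: pb_set_nt)
  then have "x \<in> H A B" by (simp add: composable_def)
  with 6 x show ?case using obs by (simp add: plus_mem ccod_plus)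
next
  case (7 x x' x'')
  then have x: "(x, x') \<in> composable H cdom ccod A B" "(x', x'') \<in> composable H cdom ccod A B"
    using obs by (simp_all add: pb_set_nt)
  have "(x, plus A B (x', x'')) \<in> composable H cdom ccod A B"
    "(plus A B (x, x'), x'') \<in> composable H cdom ccod A B"
    using x plus_mem[OF obs x(1)] plus_mem[OF obs x(2)] ccod_plus[OF obs x(2)] cdom_plus[OF obs x(1)]
    by (simp_all add: composable_def)
  with 7 x show ?case using obs by (simp add: pb_set_nt plus_assoc)
qed

lemma in_two_cell_structures:
  "(cell_fctr, dom_nt, cod_nt, zero_nt, plus_nt) \<in> two_cell_structures \<C>"
  using internal_category_data fibre_category by (simp add: two_cell_structures_iff)

text \<open>The original actions return because H(f, 1)(x) = 1 (x f) = x f and H(1, g)(y) = g (y 1)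
  = g y. Extensionality of all the given families then makes this an equality of tuples.\<close>

lemma action_data_of_nt:
  "action_data_of \<C> (cell_fctr, dom_nt, cod_nt, zero_nt, plus_nt) =
    (H, cdom, ccod, zero, plus, ract, lact)"
proof -
  have pb: "{(x, x'). x \<in> H A B \<and> x' \<in> H A B \<and>
        app (at dom_nt (A, B)) x = app (at cod_nt (A, B)) x'} =
      composable H cdom ccod A B" if "A \<in> Ob \<C>" "B \<in> Ob \<C>" for A B
    using that by (auto simp: composable_def)
  have "(\<lambda>A \<in> Ob \<C>. \<lambda>B \<in> Ob \<C>. fob cell_fctr (A, B)) = H"
    by (rule restrict1_eq[OF H_type], rule restrict1_eq[OF PiE_mem[OF H_type]]) simp_all
  moreover have "(\<lambda>A \<in> Ob \<C>. \<lambda>B \<in> Ob \<C>. \<lambda>x \<in> fob cell_fctr (A, B). the_mor (app (at dom_nt (A, B)) x)) = cdom"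
    by (subst restrict2_eq[OF cdom_type, symmetric]) (auto cong: restrict_cong)
  moreover have "(\<lambda>A \<in> Ob \<C>. \<lambda>B \<in> Ob \<C>. \<lambda>x \<in> fob cell_fctr (A, B). the_mor (app (at cod_nt (A, B)) x)) = ccod"
    by (subst restrict2_eq[OF ccod_type, symmetric]) (auto cong: restrict_cong)
  moreover have "(\<lambda>A \<in> Ob \<C>. \<lambda>B \<in> Ob \<C>. \<lambda>f \<in> hom \<C> A B. app (at zero_nt (A, B)) (Mor f)) = zero"
    by (rule restrict2_eq[OF zero_type]) simp
  moreover have "(\<lambda>A \<in> Ob \<C>. \<lambda>B \<in> Ob \<C>.
      \<lambda>(x, x') \<in> {(x, x') \<in> fob cell_fctr (A, B) \<times> fob cell_fctr (A, B).
                    app (at dom_nt (A, B)) x = app (at cod_nt (A, B)) x'}.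
        app (at plus_nt (A, B)) (Pr x x')) = plus"
    by (rule trans[OF _ restrict2_eq[OF plus_type, of "\<lambda>A B (x, x'). app (at plus_nt (A, B)) (Pr x x')"]])
      (auto simp: pb pb_set_nt cong: restrict_cong)
  moreover have "(\<lambda>A \<in> Ob \<C>. \<lambda>B \<in> Ob \<C>. \<lambda>C \<in> Ob \<C>. \<lambda>(x, f) \<in> fob cell_fctr (B, C) \<times> hom \<C> A B.
      app (far cell_fctr (f, \<one> C)) x) = ract"
    by (rule trans[OF _ restrict3_eq[OF ract_type, of "\<lambda>A B C (x, f). app (far cell_fctr (f, \<one> C)) x"]])
      (auto simp: app_far_cell_fctr[OF _ idt_hom] act_eq[OF _ idt_hom] lact_idt ract_mem
        cong: restrict_cong)
  moreover have "(\<lambda>A \<in> Ob \<C>. \<lambda>B \<in> Ob \<C>. \<lambda>C \<in> Ob \<C>. \<lambda>(g, y) \<in> hom \<C> B C \<times> fob cell_fctr (A, B).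
      app (far cell_fctr (\<one> A, g)) y) = lact"
    by (rule trans[OF _ restrict3_eq[OF lact_type, of "\<lambda>A B C (g, y). app (far cell_fctr (\<one> A, g)) y"]])
      (auto simp: app_far_cell_fctr[OF idt_hom] act_eq[OF idt_hom] ract_idt
        cong: restrict_cong)
  ultimately show ?thesis
    by (simp only: action_data_of_def prod.case)
qed

end

section \<open>A 2-cell structure is determined by its action data\<close>

text \<open>The order of recovery is forced by the types: transformations record their source and
  target functors, so H is identified before d, c and e, and these two boundaries before m.\<close>

lemma (in category) inj_on_action_data_of:
  "inj_on (action_data_of \<C>) (two_cell_structures \<C> :: ('o, 'm, 'h) two_cell_struct set)"
proof (rule inj_onI)
  fix S S' :: "('o, 'm, 'h) two_cell_struct"
  assume S: "S \<in> two_cell_structures \<C>" "S' \<in> two_cell_structures \<C>"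
    and eq: "action_data_of \<C> S = action_data_of \<C> S'"
  obtain H d c e m H' d' c' e' m' where S_eq: "S = (H, d, c, e, m)" "S' = (H', d', c', e', m')"
    by (metis surj_pair)
  interpret a: two_cell_structure \<C> H d c e m
    using S S_eq by unfold_locales simp
  interpret b: two_cell_structure \<C> H' d' c' e' m'
    using S S_eq by unfold_locales simp
  have eqs: "a.cells = b.cells" "a.cell_dom = b.cell_dom" "a.cell_cod = b.cell_cod"
    "a.cell_zero = b.cell_zero" "a.cell_plus = b.cell_plus" "a.cell_ract = b.cell_ract"
    "a.cell_lact = b.cell_lact"
    using eq by (simp_all add: S_eq a.action_data_of_eq b.action_data_of_eq)
  have fob: "fob H (A, B) = fob H' (A, B)" if "A \<in> Ob \<C>" "B \<in> Ob \<C>" for A B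
    using eqs(1) a.cell_simps(1)[OF that] b.cell_simps(1)[OF that] by simp
  have far: "app (far H (f, g)) x = app (far H' (f, g)) x"
    if f: "f \<in> hom \<C> A' A" and g: "g \<in> hom \<C> B B'" and x: "x \<in> fob H (A, B)" for A A' B B' f g x
  proof -
    note obs = hom_Ob[OF f] hom_Ob[OF g]
    have x': "x \<in> fob H' (A, B)" using x fob obs by simp
    note 1 = idt_hom[OF obs(1)] idt_hom[OF obs(3)]
    have xf: "app (far H (f, \<one> B)) x = app (far H' (f, \<one> B)) x"
      using eqs(6) a.cell_simps(7)[OF obs(1-3) x f] b.cell_simps(7)[OF obs(1-3) x' f] by simp
    note mem = a.far_mem[OF f 1(2) x] b.far_mem[OF f 1(2) x']
    \<comment> \<open>The action data shows only the one-sided maps H(f, 1) and H(1, g); their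
      composite is H(f, g), which recovers H on all arrows.\<close>
    have "app (far H (\<one> A', g)) (app (far H (f, \<one> B)) x) =
        app (far H' (\<one> A', g)) (app (far H' (f, \<one> B)) x)"
      using eqs(7) a.cell_simps(8)[OF obs(1,3,4) g mem(1)] b.cell_simps(8)[OF obs(1,3,4) g mem(2)] xf
      by simp
    then show ?thesis
      by (simp add: a.far_far[OF f 1(2) 1(1) g x] b.far_far[OF f 1(2) 1(1) g x']
          cmp_idt_right[OF f] cmp_idt_right[OF g])
  qed
  have H: "H = H'"
    using a.data.is_functor_X(2) b.data.is_functor_X(2)
  proof (rule set_functor_eqI)
    show "category (op_prod \<C>)"
      using diagram_shape_op_prod by (rule diagram_shape.axioms)
    show "fob H j = fob H' j" if "j \<in> Ob (op_prod \<C>)" for j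
      using that fob by auto
    show "app (far H u) x = app (far H' u) x" if "u \<in> Ar (op_prod \<C>)" "x \<in> fob H (src (op_prod \<C>) u)" for u x
      using that far[OF in_hom_src_tgt in_hom_src_tgt] by auto
  qed
  \<comment> \<open>The action data contains untagged boundaries. They determine the transformation
    since every value of the hom functor is the \<open>Mor\<close> of its
    \<open>the_mor\<close>.\<close>
  have boundary: "s = s'"
    if s: "s \<in> hom a.data.\<E> H (hom_fctr \<C>)" "s' \<in> hom a.data.\<E> H (hom_fctr \<C>)"
      and eq: "\<And>A B x. \<lbrakk>A \<in> Ob \<C>; B \<in> Ob \<C>; x \<in> fob H (A, B)\<rbrakk> \<Longrightarrow>
        the_mor (app (at s (A, B)) x) = the_mor (app (at s' (A, B)) x)" for s s'
    using s
  proof (rule set_ntrans_eqI)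
    fix j x assume "j \<in> Ob (op_prod \<C>)" and x: "x \<in> fob H j"
    then obtain A B where j: "j = (A, B)" and AB: "A \<in> Ob \<C>" "B \<in> Ob \<C>" by auto
    show "app (at s j) x = app (at s' j) x"
      using a.boundary_mem(2)[OF s(1) AB] a.boundary_mem(2)[OF s(2) AB] eq[OF AB] x
      unfolding j by metis
  qed
  have d: "d = d'"
    using a.data.d_hom b.data.d_hom eqs(2) a.cell_simps(2) b.cell_simps(2)
    unfolding H by (intro boundary[unfolded H]) metis+
  have c: "c = c'"
    using a.data.c_hom b.data.c_hom eqs(3) a.cell_simps(3) b.cell_simps(3)
    unfolding H by (intro boundary[unfolded H]) metis+
  have e: "e = e'"
    using a.data.e_hom b.data.e_hom[folded H]
  proof (rule set_ntrans_eqI)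
    fix j and x :: "('m, 'h) elt"
    assume "j \<in> Ob (op_prod \<C>)" and x: "x \<in> fob (hom_fctr \<C>) j"
    then obtain A B f where "j = (A, B)" "A \<in> Ob \<C>" "B \<in> Ob \<C>" "x = Mor f" "f \<in> hom \<C> A B" by auto
    then show "app (at e j) x = app (at e' j) x"
      using eqs(4) a.cell_simps(4)[of A B f] b.cell_simps(4)[of A B f] by simp
  qed
  \<comment> \<open>The source of m' is the pullback of d' and c', so m and m' become parallel only
    once \<open>d\<close> and \<open>c\<close> have been identified.\<close>
  have m: "m = m'"
    using a.data.m_hom b.data.m_hom[folded H d c]
  proof (rule set_ntrans_eqI)
    fix j z assume j: "j \<in> Ob (op_prod \<C>)" and "z \<in> fob a.data.P j"
    then have z: "z \<in> pb_set d c j" by simp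
    then obtain A B x x' where "j = (A, B)" "A \<in> Ob \<C>" "B \<in> Ob \<C>" "z = Pr x x'"
      using j by (auto simp: pb_set_def)
    with z show "app (at m j) z = app (at m' j) z"
      using eqs(5) a.cell_simps(6)[of A B x x'] b.cell_simps(6)[of A B x x']
      by (simp add: d c)
  qed
  show "S = S'" by (simp add: S_eq H d c e m)
qed

theorem proposition3p3:
  fixes \<C> :: "('o, 'm) cat"
  assumes "category \<C>"
  shows "bij_betw (action_data_of \<C>)
    (two_cell_structures \<C> :: ('o, 'm, 'h) two_cell_struct set)
    (action_structures \<C> :: ('o, 'm, ('m, 'h) elt) action_data set)"
  unfolding bij_betw_def
proof (intro conjI equalityI subsetI)
  show "inj_on (action_data_of \<C>) (two_cell_structures \<C> :: ('o, 'm, 'h) two_cell_struct set)"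
    by (rule category.inj_on_action_data_of[OF assms])
next
  fix D
  assume "D \<in> action_data_of \<C> ` (two_cell_structures \<C> :: ('o, 'm, 'h) two_cell_struct set)"
  then obtain H d c e m where "(H, d, c, e, m) \<in> two_cell_structures \<C>"
    and D: "D = action_data_of \<C> (H, d, c, e, m :: ('o, 'm, 'h) bintrans)"
    by auto
  then interpret two_cell_structure \<C> H d c e m
    using assms by (intro two_cell_structure.intro two_cell_structure_axioms.intro)
  show "D \<in> action_structures \<C>"
    using two_cell_actions by (simp add: D action_data_of_eq action_structures_def)
next
  fix D :: "('o, 'm, ('m, 'h) elt) action_data"
  assume "D \<in> action_structures \<C>"
  then obtain H cdom ccod zero plus ract lact
    where "two_cell_actions \<C> H cdom ccod zero plus ract lact"
      and D: "D = (H, cdom, ccod, zero, plus, ract, lact)"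
    by (auto simp: action_structures_def)
  then interpret elt_actions \<C> H cdom ccod zero plus ract lact
    by (intro elt_actions.intro)
  show "D \<in> action_data_of \<C> ` (two_cell_structures \<C> :: ('o, 'm, 'h) two_cell_struct set)"
    using in_two_cell_structures action_data_of_nt unfolding D by (metis imageI)
qed

end
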